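(* Let $A$ be a commutative augmented ring with augmentation ideal $I$, and for each positive integer $n$ let $Q_n(A)=I^n/I^{n+1}$. Then there exists a positive integer $n_0$ such that $Q_n(A)\cong Q_{n+1}(A)$ (as abelian groups) for every $n\geqslant n_0$.
   Context: A commutative augmented ring is a commutative ring $A$ together with a ring homomorphism $\varepsilon: A\to\mathbb{Z}$ such that: (i) $A$ has an identity element and $\varepsilon$ preserves identity elements; (ii) the underlying additive group of $A$ is a finitely generated free abelian group; (iii) $I/I^2$ is torsion as an additive group, where $I=\ker\varepsilon$. The map $\varepsilon$ is called the augmentation map and $I$ the augmentation ideal of $A$. $I^n$ denotes the $n$-th power of the ideal $I$, and $Q_n(A)=I^n/I^{n+1}$ is the $n$-th consecutive quotient group (an additive abelian group). *)

theory Defs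
  imports "HOL-Algebra.Algebra"
begin

definition torsion_group :: "('a, 'm) monoid_scheme \<Rightarrow> bool"
  where "torsion_group G \<longleftrightarrow> (\<forall>x \<in> carrier G. \<exists>k::nat. k > 0 \<and> x [^]\<^bsub>G\<^esub> k = \<one>\<^bsub>G\<^esub>)"

text \<open>Taking the basis as a set over the element type of the group loses nothing: every basis of
  a free abelian group embeds into the group.\<close>

definition fg_free_Abelian_group :: "('a, 'm) monoid_scheme \<Rightarrow> bool"
  where "fg_free_Abelian_group G \<longleftrightarrow>
    (\<exists>S :: 'a set. G \<cong> free_Abelian_group S) \<and>
    (\<exists>B. finite B \<and> B \<subseteq> carrier G \<and> generate G B = carrier G)"

definition add_quotient :: "('a, 'm) ring_scheme \<Rightarrow> 'a set \<Rightarrow> 'a set \<Rightarrow> 'a set monoid"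
  where "add_quotient A J K = (add_monoid A)\<lparr>carrier := J\<rparr> Mod K"

definition aug_ideal :: "('a, 'm) ring_scheme \<Rightarrow> ('a \<Rightarrow> int) \<Rightarrow> 'a set"
  where "aug_ideal A \<epsilon> = a_kernel A \<Z> \<epsilon>"

text \<open>Powers of ideals are powers in the multiplicative monoid of ideals, whose product
  is the ideal product (finite sums of products) and whose unit is the whole ring.\<close>

definition aug_pow :: "('a, 'm) ring_scheme \<Rightarrow> ('a \<Rightarrow> int) \<Rightarrow> nat \<Rightarrow> 'a set"
  where "aug_pow A \<epsilon> n = aug_ideal A \<epsilon> [^]\<^bsub>ideals_set A\<^esub> n"

definition aug_quotient :: "('a, 'm) ring_scheme \<Rightarrow> ('a \<Rightarrow> int) \<Rightarrow> nat \<Rightarrow> 'a set monoid"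
  where "aug_quotient A \<epsilon> n = add_quotient A (aug_pow A \<epsilon> n) (aug_pow A \<epsilon> (n + 1))"

text \<open>\<^const>\<open>ring_hom\<close> includes preservation of the identity element.\<close>

locale comm_augmented_ring = ring_hom_cring A \<Z> \<epsilon>
  for A :: "('a, 'm) ring_scheme" (structure) and \<epsilon> :: "'a \<Rightarrow> int" +
  assumes fg_free: "fg_free_Abelian_group (add_monoid A)"
    and torsion: "torsion_group (add_quotient A (aug_ideal A \<epsilon>) (aug_pow A \<epsilon> 2))"

end

theory Submission
  imports Defs
begin

text \<open>The groups \<open>Q\<^sub>n\<close>, \<open>n > 0\<close>, are finite, and their orders are bounded by \<open>|I / m I|\<close>, where \<open>m\<close>
  annihilates \<open>I / I\<^sup>2\<close>. By the pigeonhole principle, a fixed power of every homogeneous element of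
  positive degree of the associated graded ring becomes an idempotent, up to a unit, after inverting
  any element of \<open>Q\<^sub>1\<close>. Gluing these idempotents over generators \<open>x\<close> of \<open>I\<close> produces homogeneous
  elements \<open>f\<close> and \<open>g\<close>, of degrees \<open>D\<close> and \<open>D j + 1\<close>, such that every \<open>x\<close> is nilpotent modulo \<open>f\<close> and
  modulo \<open>g\<close>. Multiplication by either one is then surjective on \<open>Q\<^sub>n\<close> for large \<open>n\<close>, hence bijective for
  large \<open>n\<close> because the orders cannot decrease forever, and
  \<open>Q\<^sub>n \<cong> Q\<^bsub>n + D j + 1\<^esub> \<cong> Q\<^bsub>n + 1\<^esub>\<close>.\<close>

section \<open>Graded filtrations with quotients of bounded order\<close>

text \<open>Bounded orders mean that the associated graded ring has only finitely many relevant
  points, in the sense of Proj. Multiplication by a homogeneous element that vanishes at none of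
  them is bijective in large degrees. Over finite residue fields an element of degree one with this
  property need not exist, so the shift by 1 cannot be expected to come from a single
  multiplication. In higher degrees there is more room, and two degrees differing by 1 modulo the
  smaller one suffice: the shift by D can be iterated and inverted, leaving a net shift by 1. Points
  and prime avoidance are replaced by idempotents, which the pigeonhole principle supplies and which
  can be glued over a finite list of generators.\<close>

text \<open>\<open>J n\<close> stands for I^n and \<open>S\<close> for generators of I. The
  assumptions are those visible in the associated graded ring: \<open>S_gen\<close> is a congruence
  modulo one degree higher, and \<open>pigeon\<close> says without forming quotients that J n / J (n
  + 1) has at most \<open>C\<close> elements. Degree 0 is excluded there since A / I is
  infinite.\<close>

locale graded_filtration =
  fixes J :: "nat \<Rightarrow> 'r::comm_ring_1 set" and S :: "'r set" and C :: nat
  assumes zero_mem [simp, intro]: "0 \<in> J n"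
    and add_mem [intro]: "a \<in> J n \<Longrightarrow> b \<in> J n \<Longrightarrow> a + b \<in> J n"
    and uminus_mem [intro]: "a \<in> J n \<Longrightarrow> - a \<in> J n"
    and mult_mem: "a \<in> J m \<Longrightarrow> b \<in> J n \<Longrightarrow> a * b \<in> J (m + n)"
    and one_mem [simp]: "1 \<in> J 0"
    and Suc_mem: "a \<in> J (Suc n) \<Longrightarrow> a \<in> J n"
    and finite_S: "finite S"
    and S_mem: "x \<in> S \<Longrightarrow> x \<in> J 1"
    and S_gen: "a \<in> J (Suc n) \<Longrightarrow>
      \<exists>y. (\<forall>x\<in>S. y x \<in> J n) \<and> a - (\<Sum>x\<in>S. x * y x) \<in> J (Suc (Suc n))"
    and C_pos: "C > 0"
    and pigeon: "n > 0 \<Longrightarrow> (\<And>i. i \<le> C \<Longrightarrow> h i \<in> J n) \<Longrightarrow>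
      \<exists>i j. i < j \<and> j \<le> C \<and> h i - h j \<in> J (Suc n)"
begin

lemma diff_mem [intro]: "a \<in> J n \<Longrightarrow> b \<in> J n \<Longrightarrow> a - b \<in> J n"
  using add_mem[of a n "- b"] uminus_mem by simp

lemma mult_mem': "a \<in> J m \<Longrightarrow> b \<in> J n \<Longrightarrow> l = m + n \<Longrightarrow> a * b \<in> J l"
  using mult_mem by simp

lemma power_mem: "a \<in> J n \<Longrightarrow> l = n * k \<Longrightarrow> a ^ k \<in> J l"
proof (induction k arbitrary: l)
  case (Suc k)
  then show ?case using mult_mem'[of a n "a ^ k" "n * k"] by auto
qed simp

lemma S_power_mem: "x \<in> S \<Longrightarrow> x ^ k \<in> J k"
  using power_mem[of x 1 k k] S_mem by simp

section \<open>Equality after inverting a generator\<close>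

text \<open>Equality in degree \<^term>\<open>n\<close> of the associated graded ring localised at the degree one
  element \<^term>\<open>x\<close>.\<close>

definition near :: "'r \<Rightarrow> nat \<Rightarrow> 'r \<Rightarrow> 'r \<Rightarrow> bool"
  where "near x n a b \<longleftrightarrow> a \<in> J n \<and> b \<in> J n \<and> (\<exists>M. x ^ M * (a - b) \<in> J (Suc (n + M)))"

lemma near_memD: "near x n a b \<Longrightarrow> a \<in> J n" "near x n a b \<Longrightarrow> b \<in> J n"
  by (auto simp: near_def)

lemma near_raise:
  assumes "x \<in> S" "x ^ M * a \<in> J (Suc (n + M))" "M \<le> M'"
  shows "x ^ M' * a \<in> J (Suc (n + M'))"
proof -
  have "x ^ (M' - M) * (x ^ M * a) \<in> J (Suc (n + M'))"
    using assms by (intro mult_mem'[OF S_power_mem assms(2)]) auto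
  then show ?thesis
    using assms(3) by (simp add: mult.assoc[symmetric] power_add[symmetric])
qed

lemma near_refl: "a \<in> J n \<Longrightarrow> near x n a a"
  by (auto simp: near_def)

lemma near_of_diff: "a \<in> J n \<Longrightarrow> b \<in> J n \<Longrightarrow> a - b \<in> J (Suc n) \<Longrightarrow> near x n a b"
  unfolding near_def by (auto intro: exI[of _ 0])

lemma near_sym: "near x n a b \<Longrightarrow> near x n b a"
  unfolding near_def
proof (elim conjE exE, intro conjI)
  fix M assume "x ^ M * (a - b) \<in> J (Suc (n + M))"
  from uminus_mem[OF this] show "\<exists>M. x ^ M * (b - a) \<in> J (Suc (n + M))"
    by (auto simp: algebra_simps)
qed

lemma near_add:
  assumes "x \<in> S" "near x n a b" "near x n a' b'"
  shows "near x n (a + a') (b + b')"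
proof -
  from assms obtain M M' where M: "x ^ M * (a - b) \<in> J (Suc (n + M))"
    "x ^ M' * (a' - b') \<in> J (Suc (n + M'))" unfolding near_def by blast
  have "x ^ max M M' * (a - b) + x ^ max M M' * (a' - b') \<in> J (Suc (n + max M M'))"
    using near_raise[OF assms(1) M(1)] near_raise[OF assms(1) M(2)] by auto
  then have "x ^ max M M' * ((a + a') - (b + b')) \<in> J (Suc (n + max M M'))"
    by (simp add: algebra_simps)
  then show ?thesis using assms unfolding near_def by blast
qed

lemma near_uminus: "near x n a b \<Longrightarrow> near x n (- a) (- b)"
  using near_sym[of x n a b] uminus_mem by (simp add: near_def)

lemma near_diff:
  "x \<in> S \<Longrightarrow> near x n a b \<Longrightarrow> near x n a' b' \<Longrightarrow> near x n (a - a') (b - b')"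
  using near_add[of x n a b "- a'" "- b'"] near_uminus by simp

lemma near_trans:
  assumes "x \<in> S" "near x n a b" "near x n b c"
  shows "near x n a c"
proof -
  have "near x n (a + b - b) (b + c - b)"
    using assms near_memD by (intro near_diff near_add near_refl) auto
  then show ?thesis by simp
qed

lemma near_mult_right:
  assumes "near x n a b" "c \<in> J k" "l = n + k"
  shows "near x l (a * c) (b * c)"
proof -
  from assms obtain M where "x ^ M * (a - b) \<in> J (Suc (n + M))" unfolding near_def by blast
  from mult_mem'[OF this assms(2), of "Suc (l + M)"]
  have "x ^ M * (a * c - b * c) \<in> J (Suc (l + M))"
    using assms(3) by (simp add: algebra_simps)
  then show ?thesis using assms mult_mem' unfolding near_def by blast
qed

lemma near_mult_left:
  "near x n a b \<Longrightarrow> c \<in> J k \<Longrightarrow> l = k + n \<Longrightarrow> near x l (c * a) (c * b)"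
  using near_mult_right[of x n a b c k l] by (simp add: ac_simps)

lemma near_mult:
  assumes "x \<in> S" "near x n a b" "near x k c d" "l = n + k"
  shows "near x l (a * c) (b * d)"
proof (rule near_trans[OF assms(1)])
  show "near x l (a * c) (b * c)"
    using near_mult_right[OF assms(2) near_memD(1)[OF assms(3)] assms(4)] .
  show "near x l (b * c) (b * d)"
    using near_mult_left[OF assms(3) near_memD(2)[OF assms(2)] assms(4)] .
qed

lemma near_power_mult:
  assumes x: "x \<in> S" and p: "p \<in> J d" and a: "a \<in> J n" "b \<in> J n"
    and ab: "near x (d + n) (p * a) (p * b)" and l: "l = d + n * k"
  shows "near x l (p * a ^ k) (p * b ^ k)"
  using l
proof (induction k arbitrary: l)
  case 0
  then show ?case using p by (auto intro: near_refl)
next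
  case (Suc k)
  have "near x l (p * a * a ^ k) (p * b * a ^ k)"
    using Suc.prems by (intro near_mult_right[OF ab power_mem[OF a(1)]]) auto
  moreover have "near x l (p * a ^ k * b) (p * b ^ k * b)"
    using Suc.prems by (intro near_mult_right[OF Suc.IH a(2)]) auto
  moreover have "p * b * a ^ k = p * a ^ k * b" by (simp add: ac_simps)
  ultimately have "near x l (p * a * a ^ k) (p * b ^ k * b)"
    using near_trans[OF x] by metis
  moreover have "p * a * a ^ k = p * a ^ Suc k" "p * b ^ k * b = p * b ^ Suc k"
    by (simp_all add: ac_simps)
  ultimately show ?case by simp
qed

lemma near_power:
  assumes "x \<in> S" "near x n a b" "l = n * k"
  shows "near x l (a ^ k) (b ^ k)"
  using near_power_mult[of x 1 0 a n b l k] assms near_memD[OF assms(2)] by simp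

lemma near_cancel_power:
  assumes "near x l (x ^ k * a) (x ^ k * b)" "l = k + n" "a \<in> J n" "b \<in> J n"
  shows "near x n a b"
proof -
  from assms obtain M where "x ^ M * (x ^ k * a - x ^ k * b) \<in> J (Suc (l + M))"
    unfolding near_def by blast
  then have "x ^ (M + k) * (a - b) \<in> J (Suc (n + (M + k)))"
    using assms(2) by (simp add: algebra_simps power_add)
  then show ?thesis using assms unfolding near_def by blast
qed

text \<open>\<open>v\<close> agrees with \<open>x ^ k\<close> and hence is a unit once
  \<open>x\<close> is inverted.\<close>

lemma near_cancel:
  assumes x: "x \<in> S" and v: "near x k v (x ^ k)"
    and ab: "near x l (v * a) (v * b)" and l: "l = k + n" and mem: "a \<in> J n" "b \<in> J n"
  shows "near x n a b"
proof (rule near_cancel_power[OF _ l mem])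
  have "near x l (x ^ k * a) (v * a)" "near x l (v * b) (x ^ k * b)"
    using near_mult_right[OF v _ l] mem near_sym by blast+
  with ab show "near x l (x ^ k * a) (x ^ k * b)" using near_trans[OF x] by blast
qed

text \<open>The \<open>C + 1\<close> products \<open>u\<^sup>i x\<^bsup>e(C - i)\<^esup>\<close> cannot all be distinct in degree \<open>e C\<close>, so after
  inverting \<open>x\<close> the fraction \<open>t = u / x\<^sup>e\<close> satisfies \<open>t\<^sup>i = t\<^sup>j\<close> with \<open>i < j \<le> C\<close>, and \<open>t\<close> raised to
  the power \<open>C!\<close> is idempotent.\<close>

lemma near_idem:
  assumes x: "x \<in> S" and e: "e > 0" and u: "u \<in> J e" and l: "l = 2 * (e * fact C)"
  shows "near x l (u ^ fact C * u ^ fact C) (u ^ fact C * x ^ (e * fact C))"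
proof -
  define h where "h i = u ^ i * x ^ (e * (C - i))" for i
  have xp: "x ^ k \<in> J k" for k by (rule S_power_mem[OF x])
  have h: "h i \<in> J (e * C)" if "i \<le> C" for i
    unfolding h_def using that
    by (intro mult_mem'[OF power_mem[OF u] xp]) (auto simp: algebra_simps simp flip: distrib_left)
  obtain i j where ij: "i < j" "j \<le> C" "h i - h j \<in> J (Suc (e * C))"
    using pigeon[of "e * C" h] h e C_pos by auto
  define b where "b = j - i"
  have b: "b > 0" "b \<le> C" "j = i + b" using ij by (auto simp: b_def)
  have "near x (e * C) (h i) (h j)"
    using ij h by (intro near_of_diff) auto
  moreover have "h i = x ^ (e * (C - j)) * (u ^ i * x ^ (e * b))"
  proof -
    have "C - i = (C - j) + b" using ij b by simp
    then show ?thesis unfolding h_def by (simp add: distrib_left power_add ac_simps)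
  qed
  moreover have "h j = x ^ (e * (C - j)) * (u ^ i * u ^ b)"
    unfolding h_def b(3) by (simp add: power_add ac_simps)
  ultimately have 1: "near x (e * C) (x ^ (e * (C - j)) * (u ^ i * x ^ (e * b)))
      (x ^ (e * (C - j)) * (u ^ i * u ^ b))" by simp
  have "near x (e * j) (u ^ i * x ^ (e * b)) (u ^ i * u ^ b)"
  proof (rule near_cancel_power[OF 1])
    show "e * C = e * (C - j) + e * j"
      using ij by (simp flip: distrib_left)
    have "e * j = e * i + e * b" using b(3) by (simp add: distrib_left)
    then show "u ^ i * x ^ (e * b) \<in> J (e * j)" "u ^ i * u ^ b \<in> J (e * j)"
      using mult_mem[OF power_mem[OF u refl] xp] mult_mem[OF power_mem[OF u refl] power_mem[OF u refl]]
      by auto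
  qed
  \<comment> \<open>So far t^i = t^(i + b). Multiplying by t^(C - i) removes the unknown
    \<open>i\<close>. Since \<open>b\<close> divides C!, iterating gives t^C = t^(C + C!), and a
    last factor t^(C! - C) makes t^(C!) idempotent.\<close>
  then have "near x (e * (C - i) + e * j) (u ^ (C - i) * (u ^ i * x ^ (e * b)))
      (u ^ (C - i) * (u ^ i * u ^ b))"
    by (rule near_mult_left[OF _ power_mem[OF u refl] refl])
  moreover have "u ^ (C - i) * u ^ i = u ^ C"
    using ij by (simp flip: power_add)
  moreover have "e * (C - i) + e * j = e * C + e * b"
    using ij b by (simp flip: distrib_left)
  ultimately have "near x (e * C + e * b) (u ^ C * x ^ (e * b)) (u ^ C * u ^ b)"
    by (metis mult.assoc)
  then have "near x (e * C + e * b * (fact C div b)) (u ^ C * (x ^ (e * b)) ^ (fact C div b))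
      (u ^ C * (u ^ b) ^ (fact C div b))"
    by (rule near_power_mult[OF x power_mem[OF u refl] xp power_mem[OF u refl] _ refl])
  moreover have "b * (fact C div b) = fact C"
    using b dvd_fact[of b C] by simp
  ultimately have "near x (e * C + e * fact C) (u ^ C * x ^ (e * fact C)) (u ^ C * u ^ fact C)"
    by (metis power_mult mult.assoc)
  then have "near x (e * (fact C - C) + (e * C + e * fact C))
      (u ^ (fact C - C) * (u ^ C * x ^ (e * fact C))) (u ^ (fact C - C) * (u ^ C * u ^ fact C))"
    by (rule near_mult_left[OF _ power_mem[OF u refl] refl])
  moreover have "u ^ (fact C - C) * u ^ C = u ^ fact C"
    using fact_ge_self[of C] by (simp flip: power_add)
  moreover have "e * (fact C - C) + (e * C + e * fact C) = l"
    using fact_ge_self[of C] l by (simp add: diff_mult_distrib2)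
  ultimately have "near x l (u ^ fact C * x ^ (e * fact C)) (u ^ fact C * u ^ fact C)"
    by (metis mult.assoc)
  then show ?thesis by (rule near_sym)
qed


text \<open>Induction step: where \<open>x\<close> is inverted, \<open>F\<close> and \<open>y\<^sup>E\<close> are idempotents up to a power of \<open>x\<close>, and
  \<open>f'\<close> is their union \<open>F + y\<^sup>E - F y\<^sup>E\<close> with all terms brought to degree \<open>2 E\<close>.\<close>

lemma ex_local_power:
  assumes "finite Y" "Y \<subseteq> S"
  shows "\<exists>D>0. \<exists>f\<in>J D. \<forall>x\<in>Y. near x D f (x ^ D)"
  using assms
proof (induction Y rule: finite_induct)
  case empty
  then show ?case by (intro exI[of _ 1]) auto
next
  case (insert y Y)
  then obtain D f where D: "D > 0" and f: "f \<in> J D" and fY: "\<And>x. x \<in> Y \<Longrightarrow> near x D f (x ^ D)"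
    by auto
  define c E F where "c = (fact C :: nat)" and "E = D * c" and "F = f ^ c"
  have y: "y \<in> S" and Y: "Y \<subseteq> S" using insert.prems by auto
  have F: "F \<in> J E" using power_mem[OF f] by (simp add: F_def E_def)
  have EE: "2 * E = E + E" by simp
  have yp: "y ^ n \<in> J n" for n by (rule S_power_mem[OF y])
  \<comment> \<open>The squares \<open>F * F\<close> and \<open>y ^ E * y ^ E\<close> raise the
    degree because the unit \<open>x ^ E\<close> depends on \<open>x\<close> and cannot occur in the
    definition. At \<open>y\<close> the first two terms cancel; at an \<open>x\<close> where
    \<open>F\<close> is already \<open>x ^ E\<close> the last two do.\<close>
  define f' where "f' = (F * F - F * y ^ E) + y ^ E * y ^ E"
  have f': "f' \<in> J (2 * E)"
    unfolding f'_def by (intro add_mem diff_mem mult_mem'[OF F F] mult_mem'[OF F yp] mult_mem'[OF yp yp]) auto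
  have "near x (2 * E) f' (x ^ (2 * E))" if "x \<in> insert y Y" for x
  proof (cases "x = y")
    case True
    have 1: "near y (2 * E) (F * F) (F * y ^ E)"
      using near_idem[OF y D f refl] by (simp add: F_def E_def c_def)
    have "near y (2 * E) f' ((F * y ^ E - F * y ^ E) + y ^ E * y ^ E)"
      unfolding f'_def
      by (intro near_add[OF y] near_diff[OF y] near_refl 1 mult_mem'[OF F yp EE] mult_mem'[OF yp yp EE])
    then show ?thesis by (simp add: True flip: power_add mult_2)
  next
    case False
    with that Y have xY: "x \<in> Y" and x: "x \<in> S" by auto
    have xp: "x ^ n \<in> J n" for n by (rule S_power_mem[OF x])
    have Fx: "near x E F (x ^ E)"
      using near_power[OF x fY[OF xY], of E c] by (simp add: F_def E_def power_mult)
    have 1: "near x (2 * E) (F * F) (x ^ E * x ^ E)" "near x (2 * E) (F * y ^ E) (x ^ E * y ^ E)"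
      by (rule near_mult[OF x Fx Fx EE] near_mult_right[OF Fx yp EE])+
    have 2: "near x (2 * E) (y ^ E * y ^ E) (y ^ E * x ^ E)"
      using near_idem[OF x D yp[of D], of "2 * E"] by (simp add: E_def c_def power_mult)
    have "near x (2 * E) f' ((x ^ E * x ^ E - x ^ E * y ^ E) + y ^ E * x ^ E)"
      unfolding f'_def by (intro near_add[OF x] near_diff[OF x] 1 2)
    then show ?thesis by (simp add: mult.commute flip: power_add mult_2)
  qed
  moreover have "2 * E > 0" using D by (simp add: E_def c_def)
  ultimately show ?case using f' by blast
qed

text \<open>With \<open>v\<close> serving as the unit, \<open>u\<close> and \<open>v - u\<close> behave like complementary idempotents, where \<open>u\<close>
  marks the locus on which \<open>g\<close> is invertible; \<open>g'\<close> keeps \<open>g\<close> there and uses \<open>y f\<^sup>j\<close> elsewhere.\<close>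

lemma ex_local_power_Suc:
  assumes D: "D > 0" and f: "f \<in> J D" and fS: "\<And>x. x \<in> S \<Longrightarrow> near x D f (x ^ D)"
    and "finite Y" "Y \<subseteq> S"
  shows "\<exists>j. \<exists>g\<in>J (D * j + 1). \<forall>x\<in>Y.
    near x ((D * j + 1) * (D * fact C)) (g ^ (D * fact C)) (x ^ ((D * j + 1) * (D * fact C)))"
  using \<open>finite Y\<close> \<open>Y \<subseteq> S\<close>
proof (induction Y rule: finite_induct)
  case empty
  then show ?case by auto
next
  case (insert y Y)
  define c M where "c = (fact C :: nat)" and "M = D * c"
  from insert obtain j g where g: "g \<in> J (D * j + 1)"
    and gY: "\<And>x. x \<in> Y \<Longrightarrow> near x ((D * j + 1) * M) (g ^ M) (x ^ ((D * j + 1) * M))"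
    by (auto simp: M_def c_def)
  \<comment> \<open>\<open>v\<close> is a single element agreeing with \<open>x ^ (a * M)\<close> at
    every generator, so it replaces the varying powers of \<open>x\<close>. The exponent
    \<open>M\<close> is a multiple of C!, which makes \<open>u\<close> idempotent relative to
    \<open>v\<close>, and of \<open>D\<close>, which lets \<open>y ^ M\<close> be compared with
    \<open>f ^ c\<close>.\<close>
  define a u v where "a = D * j + 1" and "u = g ^ M" and "v = f ^ (a * c)"
  define q where "q = y * f ^ j"
  have y: "y \<in> S" and Y: "Y \<subseteq> S" using insert.prems by auto
  have a: "a > 0" by (simp add: a_def)
  have g: "g \<in> J a" using g by (simp add: a_def)
  have q: "q \<in> J a"
    using mult_mem'[OF S_power_mem[OF y, of 1] power_mem[OF f refl], of a j] by (simp add: q_def a_def)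
  have u: "u \<in> J (a * M)" using power_mem[OF g] by (simp add: u_def)
  have v: "v \<in> J (a * M)" using power_mem[OF f, of "a * M" "a * c"] by (simp add: v_def M_def ac_simps)
  note vu = diff_mem[OF v u]
  have vx: "near x (a * M) v (x ^ (a * M))" if "x \<in> S" for x
    using near_power[OF that fS[OF that], of "a * M" "a * c"]
    by (simp add: v_def M_def ac_simps flip: power_mult)
  have uu: "near x (a * M + a * M) (u * u) (u * v)" if x: "x \<in> S" for x
  proof -
    have e: "a * D > 0" using a D by simp
    have "near x (a * M + a * M) (u * u) (u * x ^ (a * M))"
      using near_idem[OF x e power_mem[OF g refl], of "a * M + a * M"]
      by (simp add: u_def M_def c_def ac_simps flip: power_mult)
    from near_trans[OF x this near_mult_left[OF near_sym[OF vx[OF x]] u refl]]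
    show ?thesis .
  qed
  define g' where "g' = g * u + q * (v - u)"
  have g': "g' \<in> J (a + a * M)"
    unfolding g'_def by (intro add_mem mult_mem'[OF g u refl] mult_mem'[OF q vu refl])
  have gv: "g * v \<in> J (a + a * M)" and qv: "q * v \<in> J (a + a * M)"
    by (intro mult_mem'[OF g v refl] mult_mem'[OF q v refl])+
  let ?n = "(a + a * M) * M"
  have g'M: "g' ^ M \<in> J ?n" by (rule power_mem[OF g' refl])
  have vM: "v ^ M \<in> J (a * M * M)" by (rule power_mem[OF v refl])
  have n: "?n = a * M + a * M * M" by (simp add: distrib_right)
  have vvM: "v * v ^ M \<in> J ?n" by (rule mult_mem'[OF v vM n])
  \<comment> \<open>Where \<open>u\<close> is invertible, \<open>u * (v - u)\<close> vanishes, so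
    \<open>g'\<close> acts as \<open>g * v\<close>. Since \<open>g ^ M = u\<close>, its power
    becomes \<open>v * v ^ M\<close>, the common target on both parts.\<close>
  have ug': "near x (a * M + ?n) (u * g' ^ M) (u * (v * v ^ M))" if x: "x \<in> S" for x
  proof -
    have 1: "near x (a + (a * M + a * M)) (g * (u * u) + q * (u * v - u * u))
        (g * (u * v) + q * (u * v - u * v))"
      by (intro near_add[OF x] near_mult_left[OF _ g refl] near_mult_left[OF _ q refl]
          near_diff[OF x] uu[OF x] near_refl mult_mem'[OF u v refl])
    have "near x (a * M + (a + a * M)) (u * g') (u * (g * v))"
      using 1 by (simp add: g'_def algebra_simps)
    from near_power_mult[OF x u g' gv this refl]
    have 2: "near x (a * M + ?n) (u * g' ^ M) (u * (g * v) ^ M)" .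
    have "near x (a * M + ?n) (u * u * v ^ M) (u * v * v ^ M)"
      by (rule near_mult_right[OF uu[OF x] vM]) (simp add: n)
    then have "near x (a * M + ?n) (u * (g * v) ^ M) (u * (v * v ^ M))"
      by (simp add: u_def power_mult_distrib ac_simps)
    from near_trans[OF x 2 this] show ?thesis .
  qed
  have "near x ?n (g' ^ M) (v * v ^ M)" if "x \<in> insert y Y" for x
  proof (cases "x = y")
    case True
    \<comment> \<open>On the complementary part \<open>(v - u) * u\<close> vanishes and
      \<open>(v - u) * (v - u)\<close> equals \<open>(v - u) * v\<close>, so \<open>g'\<close> acts
      as \<open>q * v\<close>. The two parts are added at the end and the unit \<open>v\<close> is
      cancelled.\<close>
    have 1: "near y (a + (a * M + a * M)) (g * (u * v - u * u) + q * ((v * v - u * v) - (u * v - u * u)))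
        (g * (u * v - u * v) + q * ((v * v - u * v) - (u * v - u * v)))"
      by (intro near_add[OF y] near_mult_left[OF _ g refl] near_mult_left[OF _ q refl]
          near_diff[OF y] uu[OF y] near_refl mult_mem'[OF u v refl] mult_mem'[OF v v refl])
    have "near y (a * M + (a + a * M)) ((v - u) * g') ((v - u) * (q * v))"
      using 1 by (simp add: g'_def algebra_simps)
    from near_power_mult[OF y vu g' qv this refl]
    have 2: "near y (a * M + ?n) ((v - u) * g' ^ M) ((v - u) * (q * v) ^ M)" .
    have "near y (a * M) (y ^ M * f ^ (j * M)) (f ^ c * f ^ (j * M))"
    proof (rule near_mult_right)
      show "near y M (y ^ M) (f ^ c)"
        using near_power[OF y near_sym[OF fS[OF y]], of M c] by (simp add: M_def power_mult)
      show "f ^ (j * M) \<in> J (D * (j * M))" by (rule power_mem[OF f refl])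
    qed (simp add: a_def distrib_right)
    moreover have "f ^ c * f ^ (j * M) = v"
      by (simp add: v_def a_def M_def distrib_right ac_simps flip: power_add)
    ultimately have "near y (a * M) (q ^ M) v"
      by (simp add: q_def power_mult_distrib power_mult)
    from near_mult_right[OF this vM n]
    have "near y ?n ((q * v) ^ M) (v * v ^ M)" by (simp add: power_mult_distrib)
    from near_trans[OF y 2 near_mult_left[OF this vu refl]]
    have "near y (a * M + ?n) ((v - u) * g' ^ M) ((v - u) * (v * v ^ M))" .
    from near_add[OF y this ug'[OF y]]
    have "near y (a * M + ?n) (v * g' ^ M) (v * (v * v ^ M))"
      by (simp add: algebra_simps)
    from near_cancel[OF y vx[OF y] this refl g'M vvM]
    show ?thesis by (simp add: True)
  next
    case False
    with that Y have xY: "x \<in> Y" and x: "x \<in> S" by auto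
    \<comment> \<open>At the generators already treated \<open>u\<close> is the whole unit, so the
      complementary part is empty.\<close>
    have uv: "near x (a * M) u v"
      using near_trans[OF x gY[OF xY, folded a_def u_def] near_sym[OF vx[OF x]]] .
    have "near x (a * M + ?n) (v * g' ^ M) (u * g' ^ M)"
      by (rule near_mult_right[OF near_sym[OF uv] g'M refl])
    from near_trans[OF x this near_trans[OF x ug'[OF x] near_mult_right[OF uv vvM refl]]]
    have "near x (a * M + ?n) (v * g' ^ M) (v * (v * v ^ M))" .
    from near_cancel[OF x vx[OF x] this refl g'M vvM] show ?thesis .
  qed
  moreover have "near x ?n (v * v ^ M) (x ^ ?n)" if "x \<in> insert y Y" for x
  proof -
    from that y Y have x: "x \<in> S" by auto
    have "near x ?n (v ^ Suc M) ((x ^ (a * M)) ^ Suc M)"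
      by (rule near_power[OF x vx[OF x]]) (simp add: algebra_simps)
    then show ?thesis by (simp add: algebra_simps flip: power_mult power_add)
  qed
  ultimately have g'x: "near x ?n (g' ^ M) (x ^ ?n)" if "x \<in> insert y Y" for x
    using near_trans that y Y by blast
  \<comment> \<open>The new degree is still 1 modulo \<open>D\<close> because \<open>M\<close> is a
    multiple of \<open>D\<close>.\<close>
  have "a + a * M = D * (j + c * a) + 1"
    by (simp add: M_def a_def algebra_simps)
  with g' g'x show ?case
    by (intro exI[of _ "j + c * a"] bexI[of _ g']) (simp_all add: M_def c_def)
qed

section \<open>From local units to surjectivity in large degrees\<close>

text \<open>\<open>P\<close> plays the role of a homogeneous ideal of the associated graded ring
  modulo which every generator is nilpotent. A monomial whose degree exceeds the sum of the
  nilpotency exponents contains some generator to a sufficient power, so the ideal contains all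
  large degrees.\<close>

lemma graded_radical:
  fixes P :: "nat \<Rightarrow> 'r set"
  assumes add: "\<And>n a b. a \<in> P n \<Longrightarrow> b \<in> P n \<Longrightarrow> a + b \<in> P n"
    and mult: "\<And>m n a b. a \<in> P m \<Longrightarrow> b \<in> J n \<Longrightarrow> a * b \<in> P (m + n)"
    and higher: "\<And>n a. a \<in> J (Suc n) \<Longrightarrow> a \<in> P n"
    and power: "\<And>x. x \<in> S \<Longrightarrow> \<exists>k. x ^ k \<in> P k"
  shows "\<exists>N. \<forall>n\<ge>N. J n \<subseteq> P n"
proof -
  define k where "k x = (SOME k. x ^ k \<in> P k)" for x
  have k: "x ^ k x \<in> P (k x)" if "x \<in> S" for x
    unfolding k_def using power[OF that] by (rule someI_ex)
  have P_sum: "sum h Y \<in> P n" if "finite Y" "\<And>x. x \<in> Y \<Longrightarrow> h x \<in> P n" for h :: "'r \<Rightarrow> 'r" and Y n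
    using that by (induction Y rule: finite_induct) (auto intro: add higher)
  have monomial: "(\<Prod>x\<in>S. x ^ e x) \<in> J (sum e S)" for e
    using finite_S S_mem
    by (induction S rule: finite_induct) (auto intro!: mult_mem power_mem)
  \<comment> \<open>Generators are moved one at a time from \<open>a\<close> into the monomial; the
    induction is on the degree left in \<open>a\<close>, and each error term lies one degree higher,
    where \<open>higher\<close> absorbs it.\<close>
  have *: "(\<Prod>x\<in>S. x ^ e x) * a \<in> P (sum e S + t)"
    if "a \<in> J t" "sum k S < sum e S + t" for a t e
    using that
  proof (induction t arbitrary: a e)
    case 0
    obtain x where x: "x \<in> S" "k x < e x"
      using 0 sum_mono[of S e k] by force
    have "(\<Prod>x\<in>S. x ^ e x) = x ^ k x * (\<Prod>z\<in>S. z ^ (e(x := e x - k x)) z)"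
      using x finite_S
      by (simp add: prod.remove[of S x] power_add[symmetric] mult.assoc[symmetric])
    moreover have "sum e S = k x + sum (e(x := e x - k x)) S"
      using x finite_S by (simp add: sum.remove[of S x])
    ultimately show ?case
      using mult[OF mult[OF k[OF x(1)] monomial[of "e(x := e x - k x)"]] 0(1)] by simp
  next
    case (Suc t)
    obtain y where y: "\<And>x. x \<in> S \<Longrightarrow> y x \<in> J t"
      and r: "a - (\<Sum>x\<in>S. x * y x) \<in> J (Suc (Suc t))"
      using S_gen[OF Suc.prems(1)] by blast
    let ?m = "\<Prod>x\<in>S. x ^ e x"
    have "?m * (x * y x) \<in> P (sum e S + Suc t)" if x: "x \<in> S" for x
    proof -
      have "(\<Prod>z\<in>S. z ^ (e(x := Suc (e x))) z) = ?m * x"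
        using x finite_S by (simp add: prod.remove[of S x] ac_simps)
      moreover have "sum (e(x := Suc (e x))) S = Suc (sum e S)"
        using x finite_S by (simp add: sum.remove[of S x])
      ultimately show ?thesis
        using Suc.IH[OF y[OF x], of "e(x := Suc (e x))"] Suc.prems(2) by (simp add: mult.assoc)
    qed
    then have "(\<Sum>x\<in>S. ?m * (x * y x)) + ?m * (a - (\<Sum>x\<in>S. x * y x)) \<in> P (sum e S + Suc t)"
      using mult_mem[OF monomial[of e] r] by (intro add[OF P_sum[OF finite_S] higher]) simp_all
    then show ?case by (simp add: right_diff_distrib sum_distrib_left)
  qed
  show ?thesis
  proof (intro exI allI impI subsetI)
    fix n a assume "Suc (sum k S) \<le> n" "a \<in> J n"
    then show "a \<in> P n" using *[where t = n and a = a and e = "\<lambda>_. 0"] by simp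
  qed
qed

text \<open>Surjectivity in large degrees says that the ideal generated by \<open>g\<close> contains
  them, so it suffices that each \<open>x\<close> is nilpotent modulo \<open>g\<close>.\<close>

lemma eventually_mult_surj:
  assumes g: "g \<in> J E" and k: "k > 0"
    and gS: "\<And>x. x \<in> S \<Longrightarrow> near x (E * k) (g ^ k) (x ^ (E * k))"
  shows "\<exists>N. \<forall>n\<ge>N. \<forall>a\<in>J (n + E). \<exists>b\<in>J n. a - g * b \<in> J (Suc (n + E))"
proof -
  \<comment> \<open>Below degree \<open>E\<close> only the multiplier 0 is allowed; truncated
    subtraction would otherwise admit all of \<open>J 0\<close>.\<close>
  define B where "B l = (if E \<le> l then J (l - E) else {0})" for l
  define P where "P l = {p. \<exists>b\<in>B l. p - g * b \<in> J (Suc l)}" for l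
  have "\<exists>N. \<forall>n\<ge>N. J n \<subseteq> P n"
  proof (rule graded_radical)
    fix n a b assume "a \<in> P n" "b \<in> P n"
    then obtain a' b' where *: "a' \<in> B n" "b' \<in> B n" "a - g * a' \<in> J (Suc n)" "b - g * b' \<in> J (Suc n)"
      by (auto simp: P_def)
    have "a' + b' \<in> B n" using * by (auto simp: B_def split: if_splits)
    moreover have "(a + b) - g * (a' + b') \<in> J (Suc n)"
      using add_mem[OF *(3,4)] by (simp add: algebra_simps)
    ultimately show "a + b \<in> P n" unfolding P_def by blast
  next
    fix m n a b assume "a \<in> P m" and b: "b \<in> J n"
    then obtain a' where *: "a' \<in> B m" "a - g * a' \<in> J (Suc m)" by (auto simp: P_def)
    have "a' * b \<in> B (m + n)" using * b by (auto simp: B_def intro: mult_mem' split: if_splits)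
    moreover have "a * b - g * (a' * b) \<in> J (Suc (m + n))"
      using mult_mem[OF *(2) b] by (simp add: algebra_simps)
    ultimately show "a * b \<in> P (m + n)" unfolding P_def by blast
  next
    fix n a assume "a \<in> J (Suc n)"
    then show "a \<in> P n" by (auto simp: P_def B_def intro!: bexI[of _ 0])
  next
    fix x assume x: "x \<in> S"
    then obtain M where M: "x ^ M * (g ^ k - x ^ (E * k)) \<in> J (Suc (E * k + M))"
      using gS unfolding near_def by blast
    \<comment> \<open>One factor \<open>g\<close> is split off \<open>g ^ k\<close>; the rest times
      \<open>x ^ M\<close> is the multiplier producing a power of \<open>x\<close>.\<close>
    from k obtain i where i: "k = Suc i" by (cases k) auto
    have "E * k + M - E = E * i + M" by (simp add: i)
    then have "g ^ i * x ^ M \<in> B (E * k + M)"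
      using mult_mem[OF power_mem[OF g refl] S_power_mem[OF x]] by (simp add: B_def i)
    moreover have "x ^ (E * k + M) - g * (g ^ i * x ^ M) \<in> J (Suc (E * k + M))"
      using uminus_mem[OF M] by (simp add: i algebra_simps power_add)
    ultimately show "\<exists>k. x ^ k \<in> P k" unfolding P_def by blast
  qed
  then obtain N where "\<And>n. n \<ge> N \<Longrightarrow> J n \<subseteq> P n" by blast
  then show ?thesis
  proof (intro exI allI impI ballI)
    fix n a assume "N \<le> n" "a \<in> J (n + E)"
    then have "a \<in> P (n + E)" using \<open>\<And>n. n \<ge> N \<Longrightarrow> J n \<subseteq> P n\<close>[of "n + E"] by auto
    then show "\<exists>b\<in>J n. a - g * b \<in> J (Suc (n + E))" by (simp add: P_def B_def)
  qed
qed

lemma ex_eventually_mult_surj: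
  obtains D j f g N where "D > 0" "f \<in> J D" "g \<in> J (D * j + 1)"
    "\<And>n a. n \<ge> N \<Longrightarrow> a \<in> J (n + D) \<Longrightarrow> \<exists>b\<in>J n. a - f * b \<in> J (Suc (n + D))"
    "\<And>n a. n \<ge> N \<Longrightarrow> a \<in> J (n + (D * j + 1)) \<Longrightarrow>
      \<exists>b\<in>J n. a - g * b \<in> J (Suc (n + (D * j + 1)))"
proof -
  obtain D f where D: "D > 0" and f: "f \<in> J D" and fS: "\<And>x. x \<in> S \<Longrightarrow> near x D f (x ^ D)"
    using ex_local_power[OF finite_S] by auto
  obtain j g where g: "g \<in> J (D * j + 1)" and gS: "\<And>x. x \<in> S \<Longrightarrow>
      near x ((D * j + 1) * (D * fact C)) (g ^ (D * fact C)) (x ^ ((D * j + 1) * (D * fact C)))"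
    using ex_local_power_Suc[OF D f fS finite_S] by blast
  have "D * fact C > 0" using D by simp
  from eventually_mult_surj[OF g this gS] obtain N where
    N: "\<forall>n\<ge>N. \<forall>a\<in>J (n + (D * j + 1)). \<exists>b\<in>J n. a - g * b \<in> J (Suc (n + (D * j + 1)))" by blast
  obtain N' where
    N': "\<forall>n\<ge>N'. \<forall>a\<in>J (n + D). \<exists>b\<in>J n. a - f * b \<in> J (Suc (n + D))"
    using eventually_mult_surj[OF f zero_less_one, unfolded mult_1_right power_one_right, OF fS] by blast
  show thesis
  proof (rule that[OF D f g])
    show "\<exists>b\<in>J n. a - f * b \<in> J (Suc (n + D))"
      if "max N N' \<le> n" "a \<in> J (n + D)" for n a
      using N' that(2) max.boundedE[OF that(1)] by blast
    show "\<exists>b\<in>J n. a - g * b \<in> J (Suc (n + (D * j + 1)))"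
      if "max N N' \<le> n" "a \<in> J (n + (D * j + 1))" for n a
      using N that(2) max.boundedE[OF that(1)] by blast
  qed
qed

end

section \<open>Indices in abelian groups\<close>

text \<open>Cosets are taken in the ambient group, so that indices for different pairs of subgroups
  can be compared without changing carriers.\<close>

definition coset_set :: "('a, 'm) monoid_scheme \<Rightarrow> 'a set \<Rightarrow> 'a set \<Rightarrow> 'a set set"
  where "coset_set G H K = (\<lambda>h. K #>\<^bsub>G\<^esub> h) ` H"

context comm_group
begin

lemma coset_eq_iff:
  assumes "subgroup K G" "a \<in> carrier G" "b \<in> carrier G"
  shows "K #> a = K #> b \<longleftrightarrow> a \<otimes> inv b \<in> K"
  using assms by (metis is_group rcos_self repr_independence subgroup.rcos_module)

text \<open>A coset of \<open>L\<close> determines the coset of \<open>K\<close> around it. The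
  image form yields both finiteness and a bound on the cardinality.\<close>

lemma coset_set_mono:
  assumes K: "subgroup K G" and L: "subgroup L G" and "L \<subseteq> K" and H: "H \<subseteq> carrier G"
  shows "\<exists>p. coset_set G H K = p ` coset_set G H L"
proof -
  have "K #> h = (\<Union>u\<in>L #> h. K #> u)" if "h \<in> H" for h
  proof -
    have h: "h \<in> carrier G" using that H by auto
    have "K #> u = K #> h" if "u \<in> L #> h" for u
    proof -
      obtain l where l: "l \<in> L" "u = l \<otimes> h" using \<open>u \<in> L #> h\<close> by (auto simp: r_coset_def)
      then have "l \<in> K" "l \<in> carrier G" using \<open>L \<subseteq> K\<close> subgroup.mem_carrier[OF L] by auto
      then show ?thesis using h l by (simp add: coset_eq_iff[OF K] m_assoc)
    qed
    moreover have "h \<in> L #> h" using rcos_self[OF h L] .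
    ultimately show ?thesis by blast
  qed
  then show ?thesis
    unfolding coset_set_def image_image by (intro exI[of _ "\<lambda>U. \<Union>u\<in>U. K #> u"]) auto
qed

text \<open>After choosing a representative for each coset of \<open>K\<close> in \<open>H\<close>,
  every coset of \<open>L\<close> in \<open>H\<close> is the translate by such a representative of
  exactly one coset of \<open>L\<close> in \<open>K\<close>.\<close>

lemma card_coset_set_tower:
  assumes H: "subgroup H G" and K: "subgroup K G" and L: "subgroup L G"
    and LK: "L \<subseteq> K" and KH: "K \<subseteq> H"
  shows "card (coset_set G H L) = card (coset_set G H K) * card (coset_set G K L)"
proof -
  define r where "r V = (SOME h. h \<in> H \<and> V = K #> h)" for V
  have r: "r V \<in> H \<and> V = K #> r V" if "V \<in> coset_set G H K" for V
  proof -
    have "\<exists>h. h \<in> H \<and> V = K #> h" using that by (auto simp: coset_set_def)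
    then show ?thesis unfolding r_def by (rule someI_ex)
  qed
  note Hc = subgroup.mem_carrier[OF H] and Kc = subgroup.mem_carrier[OF K]
  have shift: "(L #> k) #> r V = L #> (k \<otimes> r V)" if "k \<in> K" "V \<in> coset_set G H K" for k V
    using that r Kc Hc by (intro coset_mult_assoc subgroup.subset L) auto
  have "bij_betw (\<lambda>(V, U). U #> r V) (coset_set G H K \<times> coset_set G K L) (coset_set G H L)"
  proof (rule bij_betw_imageI)
    show "inj_on (\<lambda>(V, U). U #> r V) (coset_set G H K \<times> coset_set G K L)"
    proof (rule inj_onI, clarify)
      fix V U V' U'
      assume V: "V \<in> coset_set G H K" "V' \<in> coset_set G H K"
        and U: "U \<in> coset_set G K L" "U' \<in> coset_set G K L" and eq: "U #> r V = U' #> r V'"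
      from U obtain k k' where k: "k \<in> K" "U = L #> k" "k' \<in> K" "U' = L #> k'"
        by (auto simp: coset_set_def)
      have c: "k \<in> carrier G" "k' \<in> carrier G" "r V \<in> carrier G" "r V' \<in> carrier G"
        using k V r Kc Hc by auto
      have "L #> (k \<otimes> r V) = L #> (k' \<otimes> r V')"
        using eq k(2,4) shift[OF k(1) V(1)] shift[OF k(3) V(2)] by simp
      then have 1: "(k \<otimes> r V) \<otimes> inv (k' \<otimes> r V') \<in> L"
        using coset_eq_iff[OF L] c by simp
      have split: "(k \<otimes> r V) \<otimes> inv (k' \<otimes> r V') = (k \<otimes> inv k') \<otimes> (r V \<otimes> inv (r V'))"
        using c by (simp add: inv_mult m_ac)
      have "inv (k \<otimes> inv k') \<otimes> ((k \<otimes> inv k') \<otimes> (r V \<otimes> inv (r V'))) \<in> K"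
        using subgroup.m_inv_closed[OF K subgroup.m_closed[OF K k(1) subgroup.m_inv_closed[OF K k(3)]]]
          1 LK subgroup.m_closed[OF K] unfolding split by blast
      then have "r V \<otimes> inv (r V') \<in> K" using c l_inv[of "k \<otimes> inv k'"]
        by (subst (asm) m_assoc[symmetric]) (simp_all del: l_inv)
      then have "K #> r V = K #> r V'" using coset_eq_iff[OF K] c by simp
      then have VV: "V = V'" using r[OF V(1)] r[OF V(2)] by simp
      then have "k \<otimes> inv k' \<in> L" using 1 c unfolding split by simp
      then show "V = V' \<and> U = U'" using VV k coset_eq_iff[OF L] c by simp
    qed
    show "(\<lambda>(V, U). U #> r V) ` (coset_set G H K \<times> coset_set G K L) = coset_set G H L"
    proof (intro subset_antisym subsetI)
      fix W assume "W \<in> (\<lambda>(V, U). U #> r V) ` (coset_set G H K \<times> coset_set G K L)"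
      then obtain V k where V: "V \<in> coset_set G H K" and k: "k \<in> K" and W: "W = (L #> k) #> r V"
        by (auto simp: coset_set_def)
      have "k \<otimes> r V \<in> H" using k KH r[OF V] by (intro subgroup.m_closed[OF H]) auto
      then show "W \<in> coset_set G H L" unfolding W shift[OF k V] coset_set_def by blast
    next
      fix W assume "W \<in> coset_set G H L"
      then obtain h where h: "h \<in> H" "W = L #> h" by (auto simp: coset_set_def)
      define V where "V = K #> h"
      have V: "V \<in> coset_set G H K" using h by (auto simp: V_def coset_set_def)
      have c: "h \<in> carrier G" "r V \<in> carrier G" using h r[OF V] Hc by auto
      define k where "k = h \<otimes> inv (r V)"
      have k: "k \<in> K" using r[OF V] coset_eq_iff[OF K c] by (simp add: V_def k_def)
      have "k \<otimes> r V = h" using c by (simp add: k_def m_assoc)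
      then have "W = (L #> k) #> r V" using shift[OF k V] h by simp
      moreover have "L #> k \<in> coset_set G K L" using k by (auto simp: coset_set_def)
      ultimately show "W \<in> (\<lambda>(V, U). U #> r V) ` (coset_set G H K \<times> coset_set G K L)"
        using V by force
    qed
  qed
  then show ?thesis by (metis bij_betw_same_card card_cartesian_product)
qed

section \<open>Subgroups of multiples and their indices\<close>

lemma subgroup_power_image:
  assumes H: "subgroup H G"
  shows "subgroup ((\<lambda>x. x [^] (k::nat)) ` H) G"
proof -
  note c = subgroup.mem_carrier[OF H]
  show ?thesis
  proof (rule subgroupI)
    show "(\<lambda>x. x [^] k) ` H \<subseteq> carrier G" using c by auto
    show "(\<lambda>x. x [^] k) ` H \<noteq> {}" using subgroup.one_closed[OF H] by auto
    show "inv a \<in> (\<lambda>x. x [^] k) ` H" if "a \<in> (\<lambda>x. x [^] k) ` H" for a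
    proof -
      from that obtain x where "x \<in> H" "a = x [^] k" by auto
      then show ?thesis
        using subgroup.m_inv_closed[OF H] c by (intro image_eqI[of _ _ "inv x"]) (auto simp: nat_pow_inv)
    qed
    show "a \<otimes> b \<in> (\<lambda>x. x [^] k) ` H"
      if "a \<in> (\<lambda>x. x [^] k) ` H" "b \<in> (\<lambda>x. x [^] k) ` H" for a b
    proof -
      from that obtain x y where "x \<in> H" "y \<in> H" "a = x [^] k" "b = y [^] k" by auto
      then show ?thesis
        using subgroup.m_closed[OF H] c by (intro image_eqI[of _ _ "x \<otimes> y"]) (auto simp: nat_pow_distrib)
    qed
  qed
qed

lemma generate_finprod:
  assumes S: "finite S" "S \<subseteq> carrier G" and h: "h \<in> generate G S"
  shows "\<exists>e::'a \<Rightarrow> int. h = (\<Otimes>x\<in>S. x [^] e x)"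
  using h
proof (induction h rule: generate.induct)
  case one
  have "\<one> = (\<Otimes>x\<in>S. x [^] (0::int))" by simp
  then show ?case by (intro exI[of _ "\<lambda>_. 0"])
next
  case (incl h)
  have "(\<Otimes>x\<in>S. x [^] (if x = h then 1 else 0 :: int)) = (\<Otimes>x\<in>S. if h = x then x else \<one>)"
    using S by (intro finprod_cong) (auto simp: simp_implies_def)
  also have "\<dots> = h" using finprod_singleton[OF incl S(1), of "\<lambda>x. x"] S by auto
  finally show ?case by metis
next
  case (inv h)
  have "(\<Otimes>x\<in>S. x [^] (if x = h then - 1 else 0 :: int)) = (\<Otimes>x\<in>S. if h = x then inv x else \<one>)"
    using S by (intro finprod_cong) (auto simp: int_pow_neg simp_implies_def)
  also have "\<dots> = inv h" using finprod_singleton[OF inv S(1), of "\<lambda>x. inv x"] S by auto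
  finally show ?case by metis
next
  case (eng h1 h2)
  then obtain e e' :: "'a \<Rightarrow> int" where "h1 = (\<Otimes>x\<in>S. x [^] e x)" "h2 = (\<Otimes>x\<in>S. x [^] e' x)"
    by auto
  then have "h1 \<otimes> h2 = (\<Otimes>x\<in>S. x [^] e x \<otimes> x [^] e' x)"
    using S by (subst finprod_multf) auto
  also have "\<dots> = (\<Otimes>x\<in>S. x [^] (e x + e' x))"
    using S by (intro finprod_cong) (auto simp: int_pow_mult simp_implies_def)
  finally show ?case by (intro exI[of _ "\<lambda>x. e x + e' x"])
qed

text \<open>Exponents of the generators matter only modulo \<open>k\<close>.\<close>

lemma finite_coset_set_power:
  fixes k :: nat
  assumes S: "finite S" "S \<subseteq> carrier G" and k: "k > 0"
  shows "finite (coset_set G (generate G S) ((\<lambda>x. x [^] k) ` generate G S))"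
proof -
  let ?H = "generate G S" and ?F = "\<lambda>e :: 'a \<Rightarrow> int. \<Otimes>x\<in>S. x [^] e x"
  let ?K = "(\<lambda>x. x [^] k) ` ?H"
  have H: "subgroup ?H G" using generate_is_subgroup S by blast
  have K: "subgroup ?K G" by (rule subgroup_power_image[OF H])
  have F: "?F e \<in> ?H" for e
  proof -
    have "(\<Otimes>x\<in>T. x [^] e x) \<in> ?H" if "T \<subseteq> S" for T
      using finite_subset[OF that S(1)] that
    proof (induction T rule: finite_induct)
      case (insert x T)
      then have "x [^] e x \<in> ?H"
        using subgroup_int_pow_closed[OF H] generate.incl[of x S G] by auto
      then show ?case
        using insert S subgroup.m_closed[OF H] by (subst finprod_insert) auto
    qed (simp add: generate.one)
    then show ?thesis by blast
  qed
  have F_add: "?F (\<lambda>x. e x + e' x) = ?F e \<otimes> ?F e'" for e e'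
  proof -
    have "?F (\<lambda>x. e x + e' x) = (\<Otimes>x\<in>S. x [^] e x \<otimes> x [^] e' x)"
      using S by (intro finprod_cong) (auto simp: int_pow_mult simp_implies_def)
    then show ?thesis using S by (subst (asm) finprod_multf) auto
  qed
  have F_mult: "?F (\<lambda>x. int n * e x) = ?F e [^] n" for n e
  proof (induction n)
    case (Suc n)
    have "?F (\<lambda>x. int (Suc n) * e x) = ?F (\<lambda>x. int n * e x + e x)"
      by (simp add: algebra_simps)
    then show ?case unfolding F_add using Suc by simp
  qed simp
  have "coset_set G ?H ?K \<subseteq> (\<lambda>e. ?K #> ?F e) ` (S \<rightarrow>\<^sub>E {0..<int k})"
  proof
    fix U assume "U \<in> coset_set G ?H ?K"
    then obtain h where h: "h \<in> ?H" "U = ?K #> h" by (auto simp: coset_set_def)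
    then obtain e where e: "h = ?F e" using generate_finprod[OF S] by blast
    \<comment> \<open>The restriction to \<open>S\<close> puts the remainders into an extensional
      function space, which is finite.\<close>
    let ?r = "\<lambda>x\<in>S. e x mod int k" and ?q = "\<lambda>x. e x div int k"
    have r: "?F ?r = ?F (\<lambda>x. e x mod int k)"
      using S by (intro finprod_cong) (auto simp: simp_implies_def)
    have "h = ?F (\<lambda>x. int k * ?q x + e x mod int k)" unfolding e by simp
    also have "\<dots> = ?F ?q [^] k \<otimes> ?F ?r" unfolding F_add F_mult r ..
    finally have hh: "h = ?F ?q [^] k \<otimes> ?F ?r" .
    have c: "?F e \<in> carrier G" for e using F subgroup.mem_carrier[OF H] by blast
    have "?K #> h = ?K #> ?F ?r"
      unfolding hh using c[of ?q] c[of ?r] F[of ?q]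
      by (subst coset_eq_iff[OF K]) (auto simp: m_assoc)
    moreover have "?r \<in> S \<rightarrow>\<^sub>E {0..<int k}" using k by auto
    ultimately show "U \<in> (\<lambda>e. ?K #> ?F e) ` (S \<rightarrow>\<^sub>E {0..<int k})" using h by blast
  qed
  then show ?thesis
    using finite_PiE[OF S(1), of "\<lambda>_. {0..<int k}"] finite_subset by blast
qed

text \<open>Both chains \<open>H \<ge> L \<ge> mL\<close> and \<open>H \<ge> mH \<ge> mL\<close> compute the index of \<open>mL\<close> in \<open>H\<close>, and
  \<open>[H : L] = [mH : mL]\<close> because multiplication by \<open>m\<close> is injective.\<close>

lemma card_coset_set_power:
  fixes m e :: nat
  assumes S: "finite S" "S \<subseteq> carrier G" and H: "H = generate G S"
    and torsion_free: "\<And>x (k::nat). x \<in> carrier G \<Longrightarrow> k > 0 \<Longrightarrow> x [^] k = \<one> \<Longrightarrow> x = \<one>"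
    and L: "subgroup L G" "L \<subseteq> H" and e: "e > 0" "\<And>x. x \<in> H \<Longrightarrow> x [^] e \<in> L" and m: "m > 0"
  shows "finite (coset_set G L ((\<lambda>x. x [^] m) ` L))"
    and "card (coset_set G L ((\<lambda>x. x [^] m) ` L)) = card (coset_set G H ((\<lambda>x. x [^] m) ` H))"
proof -
  let ?p = "\<lambda>x. x [^] m"
  have sH: "subgroup H G" unfolding H using generate_is_subgroup S by blast
  note Hc = subgroup.mem_carrier[OF sH]
  note mH = subgroup_power_image[OF sH, of m] and mL = subgroup_power_image[OF L(1), of m]
  have pow_H: "x [^] n \<in> H" if "x \<in> H" for x and n :: nat
    using that subgroup_int_pow_closed[OF sH, of x "int n"] by (simp add: int_pow_int)
  have pow_L: "x [^] n \<in> L" if "x \<in> L" for x and n :: nat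
    using that subgroup_int_pow_closed[OF L(1), of x "int n"] by (simp add: int_pow_int)
  \<comment> \<open>In additive terms emH is contained in mL, so the index of mL in \<open>H\<close>
    is finite because that of emH is.\<close>
  have "(\<lambda>x. x [^] (e * m)) ` H \<subseteq> ?p ` L"
    using e(2) Hc by (auto simp: nat_pow_pow[symmetric])
  then obtain p where "coset_set G H (?p ` L) = p ` coset_set G H ((\<lambda>x. x [^] (e * m)) ` H)"
    using coset_set_mono[OF mL subgroup_power_image[OF sH] _ subgroup.subset[OF sH]] by metis
  moreover have "finite (coset_set G H ((\<lambda>x. x [^] (e * m)) ` H))"
    unfolding H using finite_coset_set_power[OF S] e(1) m by simp
  ultimately have fin: "finite (coset_set G H (?p ` L))" by simp
  have "coset_set G L (?p ` L) \<subseteq> coset_set G H (?p ` L)"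
    using L(2) by (auto simp: coset_set_def)
  with fin show finL: "finite (coset_set G L (?p ` L))" by (rule rev_finite_subset)
  \<comment> \<open>The index of \<open>L\<close> in \<open>H\<close> must be finite, hence a
    nonzero \<open>card\<close>, so that it can be cancelled between the two factorisations.\<close>
  obtain p where "coset_set G H L = p ` coset_set G H (?p ` L)"
    using coset_set_mono[OF L(1) mL _ subgroup.subset[OF sH]] pow_L by (metis image_subsetI)
  with fin have "finite (coset_set G H L)" by simp
  then have pos: "card (coset_set G H L) > 0"
    using subgroup.one_closed[OF sH] by (auto simp: card_gt_0_iff coset_set_def)
  have inj: "x = y" if "x \<in> H" "y \<in> H" "?p x = ?p y" for x y
  proof -
    have "(x \<otimes> inv y) [^] m = \<one>"
      using that Hc by (simp add: nat_pow_distrib nat_pow_inv)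
    then have "x \<otimes> inv y = \<one>" using torsion_free[of "x \<otimes> inv y" m] m that Hc by simp
    then have "x \<otimes> inv y \<otimes> y = y" using that Hc by simp
    then show ?thesis using that Hc by (simp add: m_assoc)
  qed
  have "bij_betw (image ?p) (coset_set G H L) (coset_set G (?p ` H) (?p ` L))"
  proof (rule bij_betw_imageI)
    have "?p ` (L #> h) = ?p ` L #> ?p h" if "h \<in> H" for h
    proof -
      have "?p (l \<otimes> h) = ?p l \<otimes> ?p h" if "l \<in> L" for l
        using that \<open>h \<in> H\<close> Hc L(2) by (intro nat_pow_distrib) auto
      then show ?thesis by (auto simp: r_coset_def image_UN)
    qed
    then show "image ?p ` coset_set G H L = coset_set G (?p ` H) (?p ` L)"
      by (simp add: coset_set_def image_image)
    have "U \<subseteq> H" if U: "U \<in> coset_set G H L" for U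
    proof -
      from U obtain h where "h \<in> H" "U = (\<Union>l\<in>L. {l \<otimes> h})"
        by (auto simp: coset_set_def r_coset_def)
      then show ?thesis using L(2) subgroup.m_closed[OF sH] by auto
    qed
    moreover have "inj_on ?p H" using inj by (auto intro: inj_onI)
    ultimately show "inj_on (image ?p) (coset_set G H L)"
      by (meson PowI inj_on_image_Pow inj_on_subset subsetI)
  qed
  then have "card (coset_set G H L) = card (coset_set G (?p ` H) (?p ` L))"
    by (rule bij_betw_same_card)
  moreover have "card (coset_set G H (?p ` L)) = card (coset_set G H L) * card (coset_set G L (?p ` L))"
    by (rule card_coset_set_tower[OF sH L(1) mL _ L(2)]) (use pow_L in auto)
  moreover have "card (coset_set G H (?p ` L)) = card (coset_set G H (?p ` H)) * card (coset_set G (?p ` H) (?p ` L))"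
    by (rule card_coset_set_tower[OF sH mH mL]) (use pow_H L(2) in auto)
  ultimately show "card (coset_set G L (?p ` L)) = card (coset_set G H (?p ` H))"
    using pos by simp
qed

lemma torsion_quotient_power:
  assumes H: "subgroup H G" and N: "subgroup N G" "N \<subseteq> H"
    and torsion: "torsion_group (G\<lparr>carrier := H\<rparr> Mod N)" and x: "x \<in> H"
  shows "\<exists>k>0. x [^] (k::nat) \<in> N"
proof -
  let ?H = "G\<lparr>carrier := H\<rparr>"
  interpret H: group ?H using subgroup.subgroup_is_group[OF H is_group] .
  interpret H: comm_group ?H
    by unfold_locales (use subgroup.mem_carrier[OF H] m_comm in auto)
  have NH: "subgroup N ?H" using subgroup_incl[OF N(1) H N(2)] .
  then have norm: "N \<lhd> ?H" by (rule H.subgroup_imp_normal)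
  interpret q: group_hom ?H "?H Mod N" "\<lambda>x. N #>\<^bsub>?H\<^esub> x"
    using normal.r_coset_hom_Mod[OF norm] normal.factorgroup_is_group[OF norm] H.is_group
    by (simp add: group_hom_def group_hom_axioms_def)
  obtain k :: nat where k: "k > 0"
    and "(N #>\<^bsub>?H\<^esub> x) [^]\<^bsub>?H Mod N\<^esub> k = \<one>\<^bsub>?H Mod N\<^esub>"
    using torsion q.hom_closed[of x] x by (auto simp: torsion_group_def)
  then have "N #>\<^bsub>?H\<^esub> (x [^]\<^bsub>?H\<^esub> k) = N"
    using q.hom_nat_pow[of x k] x by (simp add: FactGroup_def)
  then have "x [^]\<^bsub>?H\<^esub> k \<in> N"
    using H.rcos_self[OF _ NH, of "x [^]\<^bsub>?H\<^esub> k"] H.nat_pow_closed[of x k] x by simp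
  with k show ?thesis by (auto simp: nat_pow_def)
qed

lemma generate_exponent:
  assumes T: "finite T" "T \<subseteq> carrier G" and N: "subgroup N G"
    and torsion: "\<And>x. x \<in> T \<Longrightarrow> \<exists>k>0. x [^] (k::nat) \<in> N"
  shows "\<exists>m>0. \<forall>x\<in>generate G T. x [^] (m::nat) \<in> N"
proof -
  obtain k where k: "\<And>x. x \<in> T \<Longrightarrow> k x > (0::nat)" "\<And>x. x \<in> T \<Longrightarrow> x [^] k x \<in> N"
    using torsion by metis
  define m where "m = (\<Prod>x\<in>T. k x)"
  have "m > 0" unfolding m_def using k(1) by (intro prod_pos) auto
  have m: "x [^] m \<in> N" if "x \<in> T" for x
  proof -
    have "k x dvd m" unfolding m_def using T(1) that by (rule dvd_prodI)
    then obtain n where "m = k x * n" by auto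
    then have "x [^] m = (x [^] k x) [^] int n"
      using that T by (simp add: nat_pow_pow int_pow_int subset_eq)
    then show ?thesis using subgroup_int_pow_closed[OF N k(2)[OF that]] by simp
  qed
  have "x [^] m \<in> N" if "x \<in> generate G T" for x
    using that
  proof (induction x rule: generate.induct)
    case one
    then show ?case using subgroup.one_closed[OF N] by simp
  next
    case (inv h)
    then have "h \<in> carrier G" using T by auto
    then show ?case
      using subgroup.m_inv_closed[OF N m[OF inv]] by (simp add: nat_pow_inv)
  next
    case (eng a b)
    then have "a \<in> carrier G" "b \<in> carrier G" using generate_in_carrier[OF T(2)] by auto
    then show ?case
      using subgroup.m_closed[OF N eng.IH] by (simp add: nat_pow_distrib)
  qed (rule m)
  with \<open>m > 0\<close> show ?thesis by blast
qed

end

section \<open>Presenting a commutative ring\<close>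

text \<open>Pulling the filtration back along a surjection from the monoid ring of multisets allows the
  graded argument to take place in a ring that is a type.\<close>

lemma (in cring) ex_ring_hom_onto:
  obtains \<phi> :: "('a multiset \<Rightarrow>\<^sub>0 int) \<Rightarrow> 'a"
  where "\<And>p. \<phi> p \<in> carrier R" "\<And>p q. \<phi> (p + q) = \<phi> p \<oplus> \<phi> q"
    "\<And>p q. \<phi> (p * q) = \<phi> p \<otimes> \<phi> q" "\<phi> 1 = \<one>" "carrier R \<subseteq> range \<phi>"
proof -
  \<comment> \<open>Multisets range over the whole type; elements outside the ring are read as
    zero.\<close>
  define c where "c x = (if x \<in> carrier R then x else \<zero>)" for x
  have c: "c x \<in> carrier R" for x by (simp add: c_def)
  define mon where "mon M = gfinprod R (\<lambda>x. c x [^] count M x) UNIV" for M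
  have fin: "finite {x \<in> UNIV. c x [^] count M x \<noteq> \<one>}" for M
  proof (rule finite_subset)
    show "{x \<in> UNIV. c x [^] count M x \<noteq> \<one>} \<subseteq> set_mset M"
    proof clarify
      fix x assume "c x [^] count M x \<noteq> \<one>"
      then have "count M x \<noteq> 0" by (intro notI) simp
      then show "x \<in># M" by (simp add: count_eq_zero_iff)
    qed
  qed simp
  have mon: "mon M \<in> carrier R" for M
    unfolding mon_def using c by (intro gfinprod_closed) auto
  have mon_add: "mon (M + N) = mon M \<otimes> mon N" for M N
    using gfinprod_distrib[OF fin[of M] fin[of N]] c by (simp add: mon_def nat_pow_mult Pi_def)
  have mon_empty: "mon {#} = \<one>"
    using gfinprod_eq_finprod[of "{}"] by (simp add: mon_def gfinprod_def)
  have mon_single: "mon {#a#} = a" if "a \<in> carrier R" for a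
  proof (cases "a = \<one>")
    case True
    then have "{x. c x [^] count {#a#} x \<noteq> \<one>} = {}" by (auto simp: c_def)
    then show ?thesis using True by (simp add: mon_def gfinprod_def)
  next
    case False
    then have "{x. c x [^] count {#a#} x \<noteq> \<one>} = {a}" using that by (auto simp: c_def split: if_splits)
    then show ?thesis using that by (simp add: mon_def gfinprod_def c_def)
  qed
  \<comment> \<open>The monoid ring is a polynomial ring over the integers with one variable per
    element of the type. Additively it is free on the monomials, so \<open>mon\<close> extends to an
    additive map, and multiplicativity need only be checked on monomials.\<close>
  obtain \<phi> where h: "\<phi> \<in> hom (free_Abelian_group UNIV) (add_monoid R)"
    and h_frag: "\<And>M. \<phi> (frag_of M) = mon M"
    using comm_group.free_Abelian_group_universal[OF a_comm_group, of mon UNIV] mon by auto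
  have cl: "\<phi> p \<in> carrier R" for p using hom_in_carrier[OF h, of p] by simp
  have add: "\<phi> (p + q) = \<phi> p \<oplus> \<phi> q" for p q
    using hom_mult[OF h, of p q] by simp
  have phi_zero: "\<phi> 0 = \<zero>" using add[of 0 0] cl[of 0] add.r_cancel_one by fastforce
  have phi_diff: "\<phi> (p - q) = \<phi> p \<ominus> \<phi> q" for p q
  proof -
    have "\<phi> (p - q) \<oplus> \<phi> q = \<phi> p" using add[of "p - q" q] by simp
    then show ?thesis using cl[of "p - q"] cl[of p] cl[of q]
      by (metis a_minus_def add.inv_solve_right)
  qed
  have "\<phi> (frag_of M * q) = \<phi> (frag_of M) \<otimes> \<phi> q" for M q
  proof (induction q rule: frag_induction[OF subset_UNIV, case_names zero one diff])
    case zero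
    then show ?case using cl by (simp add: phi_zero)
  next
    case (one N)
    then show ?case using mon_add by (simp add: mult_single h_frag)
  next
    case (diff a b)
    then show ?case using cl by (simp add: right_diff_distrib phi_diff diff a_minus_def r_distr r_minus)
  qed
  then have mult: "\<phi> (p * q) = \<phi> p \<otimes> \<phi> q" for p q
  proof (induction p rule: frag_induction[OF subset_UNIV, case_names zero one diff])
    case zero
    then show ?case using cl by (simp add: phi_zero)
  next
    case (diff a b)
    then show ?case using cl by (simp add: left_diff_distrib phi_diff diff a_minus_def l_distr l_minus)
  qed
  show thesis
  proof (rule that[of \<phi>])
    show "\<phi> 1 = \<one>" using h_frag[of "{#}"] mon_empty by simp
    show "carrier R \<subseteq> range \<phi>"
      using h_frag mon_single by (metis rangeI subsetI)
  qed (use cl add mult in auto)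
qed

section \<open>Powers of the augmentation ideal\<close>

text \<open>The sum over a window of \<open>d\<close> consecutive values changes by c(n + d) - c(n)
  when the window moves one place. It is therefore decreasing from \<open>N\<close> on, hence
  eventually constant, which treats all residue classes modulo \<open>d\<close> at once.\<close>

lemma shift_eventually_eq:
  fixes c :: "nat \<Rightarrow> nat"
  assumes "\<And>n. n \<ge> N \<Longrightarrow> c (n + d) \<le> c n"
  shows "\<exists>M\<ge>N. \<forall>n\<ge>M. c (n + d) = c n"
proof -
  define s where "s n = (\<Sum>i<d. c (n + i))" for n
  have s_Suc: "s (Suc n) + c n = s n + c (n + d)" for n
  proof -
    have "s n + c (n + d) = (\<Sum>i<Suc d. c (n + i))" by (simp add: s_def)
    then show ?thesis unfolding sum.lessThan_Suc_shift by (simp add: s_def)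
  qed
  have "\<exists>M\<ge>N. \<forall>n\<ge>N. s M \<le> s n"
    using ex_has_least_nat[of "\<lambda>n. n \<ge> N" N s] by blast
  then obtain M where M: "M \<ge> N" "\<And>n. n \<ge> N \<Longrightarrow> s M \<le> s n" by blast
  have s_le: "s (Suc n) \<le> s n" if "n \<ge> N" for n using s_Suc[of n] assms[OF that] by linarith
  have "s n \<le> s M" if "n \<ge> M" for n
    using that
  proof (induction n rule: dec_induct)
    case (step n)
    then show ?case using s_le[of n] M(1) by linarith
  qed simp
  then have "s n = s M" if "n \<ge> M" for n using that M by (meson order.antisym order.trans)
  then have "c (n + d) = c n" if "n \<ge> M" for n
    using s_Suc[of n] that by (metis add_left_cancel le_SucI)
  with M(1) show ?thesis by blast
qed

lemma torsion_free_fg_free: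
  assumes "group G" "fg_free_Abelian_group G" "x \<in> carrier G" "(k::nat) > 0" "x [^]\<^bsub>G\<^esub> k = \<one>\<^bsub>G\<^esub>"
  shows "x = \<one>\<^bsub>G\<^esub>"
proof -
  from assms(2) obtain S :: "'a set" and h where h: "h \<in> iso G (free_Abelian_group S)"
    by (auto simp: fg_free_Abelian_group_def is_iso_def)
  interpret h: group_hom G "free_Abelian_group S" h
    using h assms(1) by (simp add: group_hom_def group_hom_axioms_def iso_def)
  have "frag_cmul (int k) (h x) = 0"
    using h.hom_nat_pow[OF assms(3), of k] assms(5) by simp
  then have "h x = h \<one>\<^bsub>G\<^esub>" using assms(4) by simp
  moreover have "inj_on h (carrier G)" using h by (auto simp: iso_def bij_betw_def)
  ultimately show ?thesis using assms(3) by (metis h.G.one_closed inj_onD)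
qed

context comm_augmented_ring
begin

abbreviation G where "G \<equiv> add_monoid A"
abbreviation I where "I \<equiv> aug_ideal A \<epsilon>"
abbreviation J where "J \<equiv> aug_pow A \<epsilon>"

lemma aug_ideal_iff: "x \<in> I \<longleftrightarrow> x \<in> carrier A \<and> \<epsilon> x = 0"
  unfolding aug_ideal_def a_kernel_def kernel_def by simp

lemma ideal_aug_ideal: "ideal I A"
  unfolding aug_ideal_def by (rule ring.kernel_is_ideal)

lemma aug_pow_0: "J 0 = carrier A"
  by (simp add: aug_pow_def nat_pow_def ideals_set_def)

lemma aug_pow_Suc: "J (Suc n) = ideal_prod A (J n) I"
  by (simp add: aug_pow_def nat_pow_def ideals_set_def)

lemma ideal_aug_pow: "ideal (J n) A"
proof (induction n)
  case 0
  then show ?case using R.oneideal by (simp add: aug_pow_0)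
next
  case (Suc n)
  then show ?case using R.ideal_prod_is_ideal[OF _ ideal_aug_ideal] by (simp add: aug_pow_Suc)
qed

lemma aug_pow_subset: "a \<in> J n \<Longrightarrow> a \<in> carrier A"
  using ideal.Icarr[OF ideal_aug_pow] .

lemma subgroup_aug_pow: "subgroup (J n) G"
  by (rule additive_subgroup.a_subgroup[OF ideal.axioms(1)[OF ideal_aug_pow]])

lemma aug_pow_1: "J 1 = I"
proof
  show "J 1 \<subseteq> I"
    using R.ideal_prod_inter[OF R.oneideal ideal_aug_ideal] by (simp add: aug_pow_0 aug_pow_Suc)
  show "I \<subseteq> J 1"
  proof
    fix x assume "x \<in> I"
    then show "x \<in> J 1"
      using ideal_prod.prod[of \<one> "carrier A" x I A] ideal.Icarr[OF ideal_aug_ideal]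
      by (simp add: aug_pow_0 aug_pow_Suc)
  qed
qed

lemma aug_pow_Suc_subset: "J (Suc n) \<subseteq> J n"
  using R.ideal_prod_inter[OF ideal_aug_pow ideal_aug_ideal] by (simp add: aug_pow_Suc)

lemma aug_pow_mult: "a \<in> J m \<Longrightarrow> b \<in> J n \<Longrightarrow> a \<otimes> b \<in> J (m + n)"
proof (induction n arbitrary: b)
  case 0
  then show ?case using ideal.I_r_closed[OF ideal_aug_pow] by (simp add: aug_pow_0)
next
  case (Suc n)
  have a: "a \<in> carrier A" using Suc.prems aug_pow_subset by blast
  from Suc.prems(2) show ?case unfolding aug_pow_Suc
  proof (induction b rule: ideal_prod.induct)
    case (prod i j)
    have "(a \<otimes> i) \<otimes> j \<in> ideal_prod A (J (m + n)) I"
      using Suc.IH[OF Suc.prems(1) prod(1)] prod(2) by (rule ideal_prod.prod)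
    then show ?case
      using a prod ideal.Icarr[OF ideal_aug_ideal] aug_pow_subset by (simp add: R.m_assoc aug_pow_Suc)
  next
    case (sum s1 s2)
    then have "a \<otimes> s1 \<oplus> a \<otimes> s2 \<in> J (m + Suc n)"
      using subgroup.m_closed[OF subgroup_aug_pow] by simp
    moreover have "s1 \<in> carrier A" "s2 \<in> carrier A"
      using sum aug_pow_subset[of _ "Suc n"] by (auto simp: aug_pow_Suc)
    ultimately show ?case using a by (simp add: R.r_distr)
  qed
qed

section \<open>Finite generation, exponent and order\<close>

text \<open>Since the augmentation fixes integer multiples of the identity, a - \<epsilon>(a)1 is an
  additive projection of the ring onto I and carries generators to generators.\<close>

lemma ex_finite_generate_aug_ideal: "\<exists>T. finite T \<and> T \<subseteq> carrier A \<and> generate G T = I"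
proof -
  obtain B where B: "finite B" "B \<subseteq> carrier A" "generate G B = carrier A"
    using fg_free by (auto simp: fg_free_Abelian_group_def)
  define u where "u k = \<one> [^]\<^bsub>G\<^esub> (k::int)" for k
  have u: "u k \<in> carrier A" for k using group.int_pow_closed[OF R.a_group, of \<one> k] by (simp add: u_def)
  have u_hom: "u \<in> hom integer_group G"
    using group.hom_integer_group_pow[OF R.a_group, of \<one>] by (simp add: u_def[abs_def])
  have eps_hom: "\<epsilon> \<in> hom G integer_group"
    by (auto simp: hom_def)
  interpret eu: group_hom integer_group integer_group "\<epsilon> \<circ> u"
    using hom_compose[OF u_hom eps_hom] by (simp add: group_hom_def group_hom_axioms_def)
  have "u 1 = \<one>" using group.int_pow_1[OF R.a_group, of \<one>] by (simp add: u_def)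
  then have eps_u: "\<epsilon> (u k) = k" for k
    using eu.hom_int_pow[of 1 k] by simp
  define p where "p a = a \<ominus> u (\<epsilon> a)" for a
  have p: "p a \<in> carrier A" if "a \<in> carrier A" for a using that u by (simp add: p_def)
  have p_add: "p (a \<oplus> b) = p a \<oplus> p b" if "a \<in> carrier A" "b \<in> carrier A" for a b
  proof -
    have "u (\<epsilon> (a \<oplus> b)) = u (\<epsilon> a) \<oplus> u (\<epsilon> b)"
      using that Group.hom_mult[OF u_hom, of "\<epsilon> a" "\<epsilon> b"] by simp
    then show ?thesis using that u by (simp add: p_def a_minus_def R.minus_add R.a_ac)
  qed
  interpret p: group_hom G G p
    using p p_add R.a_group by (auto simp: group_hom_def group_hom_axioms_def hom_def)
  have eps_p: "\<epsilon> (p a) = 0" if "a \<in> carrier A" for a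
  proof -
    have "p a \<oplus> u (\<epsilon> a) = a"
      using that u by (simp add: p_def a_minus_def R.a_assoc R.l_neg)
    then have "\<epsilon> a = \<epsilon> (p a) + \<epsilon> a"
      using hom_add[OF p[OF that] u[of "\<epsilon> a"]] eps_u by simp
    then show ?thesis by simp
  qed
  have p_I: "p a = a" if "a \<in> I" for a
    using that int_pow_0[of G \<one>] by (simp add: p_def u_def aug_ideal_iff a_minus_def)
  have "p ` carrier A = I"
  proof (intro subset_antisym subsetI)
    show "x \<in> I" if "x \<in> p ` carrier A" for x
      using that p eps_p by (auto simp: aug_ideal_iff)
    show "x \<in> p ` carrier A" if "x \<in> I" for x
      using p_I[OF that] that by (intro image_eqI[of x p x]) (simp_all add: aug_ideal_iff)
  qed
  then have "generate G (p ` B) = I"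
    using p.generate_img[of B] B by simp
  moreover have "p ` B \<subseteq> carrier A" using B(2) p by auto
  ultimately show ?thesis using B(1) by blast
qed

lemma ex_exponent_aug_ideal:
  "\<exists>m>0. \<forall>x\<in>I. x [^]\<^bsub>G\<^esub> (m::nat) \<in> J 2"
proof -
  obtain T where T: "finite T" "T \<subseteq> carrier A" "generate G T = I"
    using ex_finite_generate_aug_ideal by blast
  have "J 2 \<subseteq> I"
    using aug_pow_Suc_subset[of 1] unfolding aug_pow_1 by (simp add: numeral_2_eq_2)
  then have "\<exists>k>0. x [^]\<^bsub>G\<^esub> (k::nat) \<in> J 2" if "x \<in> I" for x
    using comm_group.torsion_quotient_power[OF R.a_comm_group _ subgroup_aug_pow _ _ that, of 2]
      subgroup_aug_pow[of 1] torsion unfolding aug_pow_1 add_quotient_def by blast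
  moreover have "T \<subseteq> I" using T(3) generate.incl[of _ T G] by auto
  ultimately show ?thesis
    using comm_group.generate_exponent[OF R.a_comm_group T(1) _ subgroup_aug_pow, of 2] T by auto
qed

lemma aug_pow_subset_aug_ideal: "n > 0 \<Longrightarrow> J n \<subseteq> I"
proof (induction n rule: nat_induct_non_zero)
  case 1
  then show ?case by (simp only: aug_pow_1 order_refl)
next
  case (Suc n)
  then show ?case using aug_pow_Suc_subset[of n] by blast
qed

text \<open>In a product with last factor in I, the multiple \<open>m\<close> can be applied to that
  factor alone.\<close>

lemma aug_pow_exponent:
  assumes m: "\<And>x. x \<in> I \<Longrightarrow> x [^]\<^bsub>G\<^esub> (m::nat) \<in> J 2" and y: "y \<in> J (Suc n)"
  shows "y [^]\<^bsub>G\<^esub> m \<in> J (Suc (Suc n))"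
  using y unfolding aug_pow_Suc[of n]
proof (induction y rule: ideal_prod.induct)
  case (prod i j)
  have "i \<otimes> (j [^]\<^bsub>G\<^esub> m) \<in> J (n + 2)"
    using aug_pow_mult[OF prod(1) m[OF prod(2)]] .
  moreover have "i \<otimes> (j [^]\<^bsub>G\<^esub> m) = (i \<otimes> j) [^]\<^bsub>G\<^esub> m"
    using R.add_pow_rdistr[of i j m] aug_pow_subset[OF prod(1)] prod(2)
    by (simp add: add_pow_def aug_ideal_iff)
  ultimately show ?case by simp
next
  case (sum a b)
  have c: "a \<in> carrier G" "b \<in> carrier G"
    using sum(1,2) aug_pow_subset[of _ "Suc n"] by (simp_all add: aug_pow_Suc)
  have "(a \<oplus> b) [^]\<^bsub>G\<^esub> m = a [^]\<^bsub>G\<^esub> m \<oplus> b [^]\<^bsub>G\<^esub> m"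
    using comm_monoid.nat_pow_distrib[OF comm_group.axioms(1)[OF R.a_comm_group] c, of m] by simp
  then show ?case
    using subgroup.m_closed[OF subgroup_aug_pow sum(3,4)] by simp
qed

lemma carrier_aug_quotient: "carrier (aug_quotient A \<epsilon> n) = coset_set G (J n) (J (Suc n))"
  unfolding aug_quotient_def add_quotient_def FactGroup_def RCOSETS_def coset_set_def r_coset_def
  by auto

text \<open>From m I^n <= I^(n+1) the order of Q_n is at most the index of m I^n in I^n. As m^(n-1)
  I <= I^n, this index equals that of m I in I, whatever n is.\<close>

lemma card_aug_quotient_bounded:
  "\<exists>C>0. \<forall>n>0. finite (carrier (aug_quotient A \<epsilon> n)) \<and> card (carrier (aug_quotient A \<epsilon> n)) \<le> C"
proof -
  obtain T where T: "finite T" "T \<subseteq> carrier G" "generate G T = I"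
    using ex_finite_generate_aug_ideal by auto
  obtain m where m: "m > 0" "\<And>x. x \<in> I \<Longrightarrow> x [^]\<^bsub>G\<^esub> (m::nat) \<in> J 2"
    using ex_exponent_aug_ideal by blast
  let ?m = "\<lambda>H. (\<lambda>x. x [^]\<^bsub>G\<^esub> m) ` H"
  define C where "C = card (coset_set G I (?m I))"
  have torsion_free: "x = \<one>\<^bsub>G\<^esub>" if "x \<in> carrier G" "(k::nat) > 0" "x [^]\<^bsub>G\<^esub> k = \<one>\<^bsub>G\<^esub>" for x k
    using torsion_free_fg_free[OF R.a_group fg_free that] .
  have bound: "finite (coset_set G (J n) (J (Suc n))) \<and> card (coset_set G (J n) (J (Suc n))) \<le> C \<and> C > 0"
    if n: "n > 0" for n
  proof -
    have e: "x [^]\<^bsub>G\<^esub> (m ^ k) \<in> J (Suc k)" if "x \<in> I" for x k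
    proof (induction k)
      case 0
      then show ?case
        using that group.int_pow_1[OF R.a_group, of x] aug_pow_1
        by (simp add: aug_ideal_iff)
    next
      case (Suc k)
      have "(x [^]\<^bsub>G\<^esub> (m ^ k)) [^]\<^bsub>G\<^esub> m \<in> J (Suc (Suc k))"
        by (rule aug_pow_exponent[OF m(2) Suc])
      then show ?case
        using monoid.nat_pow_pow[OF group.is_monoid[OF R.a_group], of x "m ^ k" m] that
        by (simp add: aug_ideal_iff mult.commute)
    qed
    obtain k where k: "n = Suc k" using n by (cases n) auto
    note * = comm_group.card_coset_set_power[OF R.a_comm_group T(1,2) T(3)[symmetric] torsion_free
        subgroup_aug_pow aug_pow_subset_aug_ideal[OF n] _ e[of _ k, folded k] m(1)]
    have fin: "finite (coset_set G (J n) (?m (J n)))" and card: "card (coset_set G (J n) (?m (J n))) = C"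
      using * m(1) by (simp_all add: C_def)
    have "?m (J n) \<subseteq> J (Suc n)"
      using aug_pow_exponent[OF m(2)] by (auto simp: k)
    then obtain p where p: "coset_set G (J n) (J (Suc n)) = p ` coset_set G (J n) (?m (J n))"
      using comm_group.coset_set_mono[OF R.a_comm_group subgroup_aug_pow
          comm_group.subgroup_power_image[OF R.a_comm_group subgroup_aug_pow] _
          subgroup.subset[OF subgroup_aug_pow]] by metis
    have "coset_set G (J n) (?m (J n)) \<noteq> {}"
      using subgroup.one_closed[OF subgroup_aug_pow] by (auto simp: coset_set_def)
    then have "C > 0" using fin card by (metis card_gt_0_iff)
    then show ?thesis using p fin card card_image_le[OF fin, of p] by simp
  qed
  \<comment> \<open>\<open>C\<close> does not depend on the degree, so any positive degree shows
    that it is positive.\<close>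
  have "C > 0" using bound[of 1] by simp
  then show ?thesis using bound unfolding carrier_aug_quotient by blast
qed

lemma coset_aug_pow_eq_iff:
  assumes "a \<in> carrier A" "b \<in> carrier A"
  shows "J n #>\<^bsub>G\<^esub> a = J n #>\<^bsub>G\<^esub> b \<longleftrightarrow> a \<ominus> b \<in> J n"
  using comm_group.coset_eq_iff[OF R.a_comm_group subgroup_aug_pow] assms
  by (simp add: a_minus_def a_inv_def)

lemma aug_quotient_pigeonhole:
  assumes C: "finite (carrier (aug_quotient A \<epsilon> n))" "card (carrier (aug_quotient A \<epsilon> n)) \<le> C"
    and h: "\<And>i. i \<le> C \<Longrightarrow> h i \<in> J n"
  shows "\<exists>i j. i < j \<and> j \<le> C \<and> h i \<ominus> h j \<in> J (Suc n)"
proof -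
  define cl where "cl i = J (Suc n) #>\<^bsub>G\<^esub> h i" for i
  have "cl ` {..C} \<subseteq> carrier (aug_quotient A \<epsilon> n)"
    using h by (auto simp: cl_def carrier_aug_quotient coset_set_def)
  from card_mono[OF C(1) this] have "card (cl ` {..C}) \<le> C" using C(2) by linarith
  then have "\<not> inj_on cl {..C}" by (intro pigeonhole) simp
  then obtain i j where ij: "i \<le> C" "j \<le> C" "i \<noteq> j" "cl i = cl j"
    by (auto simp: inj_on_def)
  have *: "h i \<ominus> h j \<in> J (Suc n)" if "i \<le> C" "j \<le> C" "cl i = cl j" for i j
    using coset_aug_pow_eq_iff[OF aug_pow_subset[OF h[OF that(1)]] aug_pow_subset[OF h[OF that(2)]]] that(3)
    unfolding cl_def by blast
  show ?thesis
  proof (cases "i < j")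
    case True
    then show ?thesis using *[OF ij(1,2,4)] ij by blast
  next
    case False
    then show ?thesis using *[OF ij(2,1) ij(4)[symmetric]] ij by (intro exI[of _ j] exI[of _ i]) auto
  qed
qed

section \<open>Multiplication maps between the quotients\<close>

lemma ex_mult_surj_aug_quotient:
  obtains D j f g N where "D > 0" "f \<in> J D" "g \<in> J (D * j + 1)"
    "\<And>n a. n \<ge> N \<Longrightarrow> a \<in> J (n + D) \<Longrightarrow> \<exists>b\<in>J n. a \<ominus> f \<otimes> b \<in> J (Suc (n + D))"
    "\<And>n a. n \<ge> N \<Longrightarrow> a \<in> J (n + (D * j + 1)) \<Longrightarrow>
      \<exists>b\<in>J n. a \<ominus> g \<otimes> b \<in> J (Suc (n + (D * j + 1)))"
proof -
  obtain \<phi> :: "('a multiset \<Rightarrow>\<^sub>0 int) \<Rightarrow> 'a" where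
    cl: "\<And>p. \<phi> p \<in> carrier A" and phi_add: "\<And>p q. \<phi> (p + q) = \<phi> p \<oplus> \<phi> q"
    and phi_mult: "\<And>p q. \<phi> (p * q) = \<phi> p \<otimes> \<phi> q" and phi_1: "\<phi> 1 = \<one>"
    and onto: "carrier A \<subseteq> range \<phi>"
    using R.ex_ring_hom_onto by blast
  have phi_0: "\<phi> 0 = \<zero>"
    using phi_add[of 0 0] cl[of 0] by (metis R.add.l_cancel_one' add_0)
  have phi_uminus: "\<phi> (- p) = \<ominus> \<phi> p" for p
  proof -
    have "\<phi> (- p) \<oplus> \<phi> p = \<zero>" using phi_add[of "- p" p] phi_0 by simp
    then show ?thesis using R.minus_equality[of "\<phi> (- p)" "\<phi> p"] cl by simp
  qed
  have phi_diff: "\<phi> (p - q) = \<phi> p \<ominus> \<phi> q" for p q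
    using phi_add[of p "- q"] phi_uminus[of q] by (simp add: a_minus_def)
  define s where "s x = (SOME p. \<phi> p = x)" for x
  have s: "\<phi> (s x) = x" if x: "x \<in> carrier A" for x
  proof -
    have "\<exists>p. \<phi> p = x" using onto x by (auto simp: image_def)
    then show ?thesis unfolding s_def by (rule someI_ex)
  qed
  obtain T where T: "finite T" "T \<subseteq> carrier A" "generate G T = I"
    using ex_finite_generate_aug_ideal by blast
  \<comment> \<open>Lifts of additive generators of I; they serve as ideal generators.\<close>
  define S where "S = s ` T"
  have S: "finite S" using T(1) by (simp add: S_def)
  have phi_S: "\<phi> x \<in> I" if "x \<in> S" for x
    using that s T generate.incl[of _ T G] by (auto simp: S_def)
  obtain C where C: "C > 0" "\<And>n. n > 0 \<Longrightarrow> finite (carrier (aug_quotient A \<epsilon> n))"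
      "\<And>n. n > 0 \<Longrightarrow> card (carrier (aug_quotient A \<epsilon> n)) \<le> C"
    using card_aug_quotient_bounded by blast
  define K where "K n = {p. \<phi> p \<in> J n}" for n
  have J_add: "a \<oplus> b \<in> J n" if "a \<in> J n" "b \<in> J n" for a b n
    using that by (rule additive_subgroup.a_closed[OF ideal.axioms(1)[OF ideal_aug_pow]])
  have J_inv: "\<ominus> a \<in> J n" if "a \<in> J n" for a n
    using that by (rule additive_subgroup.a_inv_closed[OF ideal.axioms(1)[OF ideal_aug_pow]])
  have J_zero: "\<zero> \<in> J n" for n
    by (rule additive_subgroup.zero_closed[OF ideal.axioms(1)[OF ideal_aug_pow]])
  \<comment> \<open>This condition is additive in \<open>z\<close>, which allows induction first
    over the ideal product and then over the additive span of \<open>T\<close>.\<close>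
  define rep where "rep n z \<longleftrightarrow> (\<exists>y. (\<forall>x\<in>S. \<phi> (y x) \<in> J n) \<and> \<phi> (\<Sum>x\<in>S. x * y x) = z)" for n z
  have rep_add: "rep n (z \<oplus> w)" if zw: "rep n z" "rep n w" for n z w
  proof -
    obtain y where y: "\<And>x. x \<in> S \<Longrightarrow> \<phi> (y x) \<in> J n" "\<phi> (\<Sum>x\<in>S. x * y x) = z"
      using zw(1) unfolding rep_def by blast
    obtain y' where y': "\<And>x. x \<in> S \<Longrightarrow> \<phi> (y' x) \<in> J n" "\<phi> (\<Sum>x\<in>S. x * y' x) = w"
      using zw(2) unfolding rep_def by blast
    have "\<phi> (\<Sum>x\<in>S. x * (y x + y' x)) = z \<oplus> w"
      using phi_add y(2) y'(2) by (simp add: distrib_left sum.distrib)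
    moreover have "\<forall>x\<in>S. \<phi> (y x + y' x) \<in> J n"
      using y(1) y'(1) J_add phi_add by simp
    ultimately show ?thesis unfolding rep_def by (intro exI[of _ "\<lambda>x. y x + y' x"]) (rule conjI)
  qed
  have rep_zero: "rep n \<zero>" for n
    unfolding rep_def using J_zero phi_0 by (intro exI[of _ "\<lambda>_. 0"]) simp
  have rep_gen: "rep n (i \<otimes> x)" if "x \<in> T" "i \<in> J n" for n i x
  proof -
    have i: "i \<in> carrier A" and x: "x \<in> carrier A" "s x \<in> S"
      using that aug_pow_subset T by (auto simp: S_def)
    let ?y = "\<lambda>z. if z = s x then s i else 0"
    have "(\<Sum>z\<in>S. z * ?y z) = s x * s i"
      using S x by (simp add: if_distrib[of "\<lambda>t. _ * t"] sum.delta cong: if_cong)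
    then have "\<phi> (\<Sum>z\<in>S. z * ?y z) = i \<otimes> x"
      using s[OF i] s[OF x(1)] i x by (simp only: phi_mult) (simp add: R.m_comm)
    moreover have "\<forall>z\<in>S. \<phi> (?y z) \<in> J n"
      using s[OF i] that(2) J_zero phi_0 by simp
    ultimately show ?thesis unfolding rep_def by (intro exI[of _ ?y]) (rule conjI)
  qed
  have rep_prod: "rep n (i \<otimes> z)" if "z \<in> generate G T" "i \<in> J n" for n i z
    using that
  proof (induction z arbitrary: i rule: generate.induct)
    case one
    then show ?case using rep_zero aug_pow_subset by simp
  next
    case (incl h)
    then show ?case by (rule rep_gen)
  next
    case (inv h)
    have c: "i \<in> carrier A" "h \<in> carrier A" using inv aug_pow_subset T by auto
    have "rep n (\<ominus> i \<otimes> h)" using rep_gen[OF inv(1) J_inv[OF inv(2)]] .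
    moreover have "\<ominus> i \<otimes> h = i \<otimes> \<ominus> h" using c by (simp add: R.l_minus R.r_minus)
    ultimately show ?case by (simp add: a_inv_def)
  next
    case (eng a b)
    have "a \<in> carrier A" "b \<in> carrier A"
      using eng(1,2) unfolding T(3) by (simp_all add: aug_ideal_iff)
    then show ?case
      using rep_add[OF eng(3)[OF eng(5)] eng(4)[OF eng(5)]] aug_pow_subset[OF eng(5)]
      by (simp add: R.r_distr)
  qed
  have rep: "rep n z" if "z \<in> J (Suc n)" for n z
    using that unfolding aug_pow_Suc
  proof (induction z rule: ideal_prod.induct)
    case (prod i j)
    then show ?case using rep_prod T(3) by simp
  qed (rule rep_add)
  interpret graded_filtration K S C
  proof
    show "0 \<in> K n" for n using J_zero phi_0 by (simp add: K_def)
    show "a + b \<in> K n" if "a \<in> K n" "b \<in> K n" for a b n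
      using that J_add by (simp add: K_def phi_add)
    show "- a \<in> K n" if "a \<in> K n" for a n
      using that J_inv by (simp add: K_def phi_uminus)
    show "a * b \<in> K (m + n)" if "a \<in> K m" "b \<in> K n" for a b m n
      using that aug_pow_mult by (simp add: K_def phi_mult)
    show "1 \<in> K 0" by (simp add: K_def phi_1 aug_pow_0)
    show "a \<in> K n" if "a \<in> K (Suc n)" for a n
      using that aug_pow_Suc_subset by (auto simp: K_def)
    show "finite S" by (rule S)
    show "x \<in> K 1" if "x \<in> S" for x
      using phi_S[OF that] unfolding K_def aug_pow_1 by simp
    show "\<exists>y. (\<forall>x\<in>S. y x \<in> K n) \<and> a - (\<Sum>x\<in>S. x * y x) \<in> K (Suc (Suc n))"
      if "a \<in> K (Suc n)" for a n
    proof -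
      have "rep n (\<phi> a)" using rep that by (simp add: K_def)
      then obtain y where y: "\<forall>x\<in>S. \<phi> (y x) \<in> J n" "\<phi> (\<Sum>x\<in>S. x * y x) = \<phi> a"
        unfolding rep_def by blast
      \<comment> \<open>The representation is exact in the ring, and the kernel of
        \<open>\<phi>\<close> lies in every \<open>K n\<close>.\<close>
      have "\<phi> (a - (\<Sum>x\<in>S. x * y x)) = \<zero>"
        using y(2) cl[of a] by (simp only: phi_diff) (simp add: a_minus_def R.r_neg)
      then have "a - (\<Sum>x\<in>S. x * y x) \<in> K (Suc (Suc n))" using J_zero by (simp add: K_def)
      with y(1) show ?thesis unfolding K_def by blast
    qed
    show "C > 0" by (rule C(1))
    show "\<exists>i j. i < j \<and> j \<le> C \<and> h i - h j \<in> K (Suc n)"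
      if "n > 0" "\<And>i. i \<le> C \<Longrightarrow> h i \<in> K n" for n h
      using aug_quotient_pigeonhole[OF C(2,3)[OF that(1)], of "\<lambda>i. \<phi> (h i)"] that(2)
      by (simp add: K_def phi_diff)
  qed
  obtain D j f g N where D: "D > 0" and f: "f \<in> K D" and g: "g \<in> K (D * j + 1)"
    and fN: "\<And>n a. n \<ge> N \<Longrightarrow> a \<in> K (n + D) \<Longrightarrow> \<exists>b\<in>K n. a - f * b \<in> K (Suc (n + D))"
    and gN: "\<And>n a. n \<ge> N \<Longrightarrow> a \<in> K (n + (D * j + 1)) \<Longrightarrow>
      \<exists>b\<in>K n. a - g * b \<in> K (Suc (n + (D * j + 1)))"
    using ex_eventually_mult_surj by metis
  have transfer: "\<exists>b\<in>J n. a \<ominus> \<phi> w \<otimes> b \<in> J k"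
    if w: "\<And>a. a \<in> K l \<Longrightarrow> \<exists>b\<in>K n. a - w * b \<in> K k" and a: "a \<in> J l" for a k l n w
  proof -
    have sa: "\<phi> (s a) = a" using s aug_pow_subset[OF a] by blast
    then have "s a \<in> K l" using a by (simp add: K_def)
    from w[OF this] obtain b where "b \<in> K n" "s a - w * b \<in> K k" by blast
    then show ?thesis unfolding K_def by (auto simp: phi_diff phi_mult sa)
  qed
  show thesis
  proof (rule that[OF D])
    show "\<phi> f \<in> J D" "\<phi> g \<in> J (D * j + 1)" using f g by (simp_all add: K_def)
    show "\<exists>b\<in>J n. a \<ominus> \<phi> f \<otimes> b \<in> J (Suc (n + D))" if "N \<le> n" "a \<in> J (n + D)" for n a
      by (rule transfer[OF fN[OF that(1)] that(2)])
    show "\<exists>b\<in>J n. a \<ominus> \<phi> g \<otimes> b \<in> J (Suc (n + (D * j + 1)))"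
      if "N \<le> n" "a \<in> J (n + (D * j + 1))" for n a
      by (rule transfer[OF gN[OF that(1)] that(2)])
  qed
qed

lemma group_aug_quotient: "group (aug_quotient A \<epsilon> n)"
proof -
  have sJ: "subgroup (J (Suc n)) (G\<lparr>carrier := J n\<rparr>)"
    using group.subgroup_incl[OF R.a_group subgroup_aug_pow subgroup_aug_pow aug_pow_Suc_subset] .
  have "group (G\<lparr>carrier := J n\<rparr>)"
    using subgroup.subgroup_is_group[OF subgroup_aug_pow R.a_group] .
  then have "comm_group (G\<lparr>carrier := J n\<rparr>)"
    by (rule group.group_comm_groupI) (use aug_pow_subset R.a_comm in auto)
  from normal.factorgroup_is_group[OF comm_group.subgroup_imp_normal[OF this sJ]]
  show ?thesis by (simp add: aug_quotient_def add_quotient_def)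
qed

text \<open>Multiplication by \<open>f\<close> raises filtration degree by \<open>d\<close> in
  numerator and denominator alike, so it descends to the quotients; \<open>surj\<close> is its
  surjectivity on representatives.\<close>

lemma ex_hom_aug_quotient:
  assumes f: "f \<in> J d"
    and surj: "\<And>a. a \<in> J (n + d) \<Longrightarrow> \<exists>b\<in>J n. a \<ominus> f \<otimes> b \<in> J (Suc (n + d))"
  shows "\<exists>h \<in> hom (aug_quotient A \<epsilon> n) (aug_quotient A \<epsilon> (n + d)).
    h ` carrier (aug_quotient A \<epsilon> n) = carrier (aug_quotient A \<epsilon> (n + d))"
proof -
  let ?H = "G\<lparr>carrier := J n\<rparr>" and ?H' = "G\<lparr>carrier := J (n + d)\<rparr>"
  let ?Q' = "aug_quotient A \<epsilon> (n + d)"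
  have comm: "comm_group (G\<lparr>carrier := J k\<rparr>)" for k
    by (rule group.group_comm_groupI[OF subgroup.subgroup_is_group[OF subgroup_aug_pow R.a_group]])
      (use aug_pow_subset R.a_comm in auto)
  have norm: "J (Suc k) \<lhd> G\<lparr>carrier := J k\<rparr>" for k
    using comm_group.subgroup_imp_normal[OF comm]
      group.subgroup_incl[OF R.a_group subgroup_aug_pow subgroup_aug_pow aug_pow_Suc_subset] by blast
  have coset: "r_coset (G\<lparr>carrier := J k\<rparr>) = r_coset G" for k
    by (intro ext) (simp add: r_coset_def)
  have fc: "f \<in> carrier A" using f aug_pow_subset by blast
  define p where "p a = J (Suc (n + d)) #>\<^bsub>G\<^esub> (f \<otimes> a)" for a
  have fJ: "f \<otimes> a \<in> J (n + d)" if "a \<in> J n" for a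
    using aug_pow_mult[OF f that] by (simp add: add.commute)
  have q: "(\<lambda>a. J (Suc (n + d)) #>\<^bsub>G\<^esub> a) \<in> hom ?H' ?Q'"
    using normal.r_coset_hom_Mod[OF norm[of "n + d"]]
    unfolding aug_quotient_def add_quotient_def coset by simp
  have "(\<lambda>a. f \<otimes> a) \<in> hom ?H ?H'"
    using fJ fc aug_pow_subset by (auto simp: hom_def R.r_distr)
  from hom_compose[OF this q] have p: "p \<in> hom ?H ?Q'"
    by (simp add: p_def[abs_def] comp_def)
  have p_eq: "p x = p y"
    if "x \<in> carrier ?H" "y \<in> carrier ?H" "J (Suc n) #>\<^bsub>?H\<^esub> x = J (Suc n) #>\<^bsub>?H\<^esub> y" for x y
  proof -
    have c: "x \<in> carrier A" "y \<in> carrier A" using that(1,2) aug_pow_subset by auto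
    have "x \<ominus> y \<in> J (Suc n)" using that(3) coset_aug_pow_eq_iff[OF c] unfolding coset by blast
    from aug_pow_mult[OF f this] have "f \<otimes> (x \<ominus> y) \<in> J (Suc (n + d))" by (simp add: add.commute)
    moreover have "f \<otimes> (x \<ominus> y) = f \<otimes> x \<ominus> f \<otimes> y"
      using c fc by (simp add: a_minus_def R.r_distr R.r_minus)
    ultimately show ?thesis using coset_aug_pow_eq_iff c fc by (simp add: p_def)
  qed
  obtain h where h: "h \<in> hom (?H Mod J (Suc n)) ?Q'" "\<And>x. x \<in> carrier ?H \<Longrightarrow> h (J (Suc n) #>\<^bsub>?H\<^esub> x) = p x"
    using FactGroup_universal[OF p norm p_eq] by blast
  have hp: "h (J (Suc n) #>\<^bsub>G\<^esub> x) = p x" if "x \<in> J n" for x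
    using h(2)[of x] that unfolding coset by simp
  have "h ` carrier (aug_quotient A \<epsilon> n) = p ` J n"
    unfolding carrier_aug_quotient coset_set_def image_image using hp by (intro image_cong) auto
  also have "\<dots> = carrier ?Q'"
  proof
    show "p ` J n \<subseteq> carrier ?Q'"
      unfolding carrier_aug_quotient coset_set_def p_def using fJ by blast
    show "carrier ?Q' \<subseteq> p ` J n"
    proof
      fix U assume "U \<in> carrier ?Q'"
      then obtain a where a: "a \<in> J (n + d)" "U = J (Suc (n + d)) #>\<^bsub>G\<^esub> a"
        by (auto simp: carrier_aug_quotient coset_set_def)
      obtain b where b: "b \<in> J n" "a \<ominus> f \<otimes> b \<in> J (Suc (n + d))" using surj[OF a(1)] by blast
      have "U = p b"
        using coset_aug_pow_eq_iff[of a "f \<otimes> b"] a b fJ[OF b(1)] aug_pow_subset by (simp add: p_def)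
      then show "U \<in> p ` J n" using b(1) by blast
    qed
  qed
  finally show ?thesis using h(1) by (auto simp: aug_quotient_def add_quotient_def)
qed

lemma eventually_iso_shift:
  assumes f: "f \<in> J d"
    and surj: "\<And>n a. n \<ge> N \<Longrightarrow> a \<in> J (n + d) \<Longrightarrow> \<exists>b\<in>J n. a \<ominus> f \<otimes> b \<in> J (Suc (n + d))"
  shows "\<exists>M. \<forall>n\<ge>M. aug_quotient A \<epsilon> n \<cong> aug_quotient A \<epsilon> (n + d)"
proof -
  let ?Q = "aug_quotient A \<epsilon>"
  have fin: "finite (carrier (?Q n))" if "n > 0" for n
    using card_aug_quotient_bounded that by blast
  have ex: "\<exists>h \<in> hom (?Q n) (?Q (n + d)). h ` carrier (?Q n) = carrier (?Q (n + d))" if "n \<ge> N" for n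
    using ex_hom_aug_quotient[OF f surj[OF that]] by blast
  \<comment> \<open>The maximum with 1 excludes Q_0, which is infinite and for which
    \<open>card\<close> is 0.\<close>
  have "card (carrier (?Q (n + d))) \<le> card (carrier (?Q n))" if "n \<ge> max 1 N" for n
    using ex[of n] fin[of n] that by (metis One_nat_def Suc_le_lessD card_image_le max.bounded_iff)
  from shift_eventually_eq[of "max 1 N" "\<lambda>n. card (carrier (?Q n))", OF this]
  obtain M where M: "M \<ge> max 1 N" "\<And>n. n \<ge> M \<Longrightarrow> card (carrier (?Q (n + d))) = card (carrier (?Q n))"
    by blast
  have "?Q n \<cong> ?Q (n + d)" if n: "n \<ge> M" for n
  proof -
    obtain h where h: "h \<in> hom (?Q n) (?Q (n + d))" "h ` carrier (?Q n) = carrier (?Q (n + d))"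
      using ex[of n] M(1) n by auto
    have "finite (carrier (?Q n))" using fin M(1) n by auto
    then have "inj_on h (carrier (?Q n))" using h(2) M(2)[OF n] by (simp add: eq_card_imp_inj_on)
    then show ?thesis using h by (auto simp: is_iso_def iso_def bij_betw_def)
  qed
  then show ?thesis by blast
qed

end

theorem mainTheorem1:
  fixes A :: "('a, 'm) ring_scheme" and \<epsilon> :: "'a \<Rightarrow> int"
  assumes "comm_augmented_ring A \<epsilon>"
  shows "\<exists>n\<^sub>0 > 0. \<forall>n \<ge> n\<^sub>0. aug_quotient A \<epsilon> n \<cong> aug_quotient A \<epsilon> (n + 1)"
proof -
  interpret comm_augmented_ring A \<epsilon> by (rule assms)
  let ?Q = "aug_quotient A \<epsilon>"
  obtain D j f g N where f: "f \<in> J D" and g: "g \<in> J (D * j + 1)"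
    and fN: "\<And>n a. n \<ge> N \<Longrightarrow> a \<in> J (n + D) \<Longrightarrow> \<exists>b\<in>J n. a \<ominus>\<^bsub>A\<^esub> f \<otimes>\<^bsub>A\<^esub> b \<in> J (Suc (n + D))"
    and gN: "\<And>n a. n \<ge> N \<Longrightarrow> a \<in> J (n + (D * j + 1)) \<Longrightarrow>
      \<exists>b\<in>J n. a \<ominus>\<^bsub>A\<^esub> g \<otimes>\<^bsub>A\<^esub> b \<in> J (Suc (n + (D * j + 1)))"
    using ex_mult_surj_aug_quotient by metis
  obtain M where M: "\<And>n. n \<ge> M \<Longrightarrow> ?Q n \<cong> ?Q (n + D)"
    using eventually_iso_shift[OF f fN] by blast
  obtain M' where M': "\<And>n. n \<ge> M' \<Longrightarrow> ?Q n \<cong> ?Q (n + (D * j + 1))"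
    using eventually_iso_shift[OF g gN] by blast
  have iter: "?Q n \<cong> ?Q (n + D * i)" if "n \<ge> M" for n i
  proof (induction i)
    case 0
    then show ?case by (simp add: iso_refl)
  next
    case (Suc i)
    have "?Q (n + D * i) \<cong> ?Q (n + D * i + D)" using M that by simp
    from iso_trans[OF Suc this] show ?case by (simp add: algebra_simps)
  qed
  have "?Q n \<cong> ?Q (n + 1)" if "n \<ge> max M M'" for n
  proof (rule iso_trans)
    show "?Q n \<cong> ?Q (n + (D * j + 1))" using M' that by simp
    \<comment> \<open>The \<open>j\<close> shifts by \<open>D\<close> start from n + 1 and are then
      read backwards.\<close>
    have "?Q (n + 1) \<cong> ?Q (n + 1 + D * j)" using iter[of "n + 1" j] that by simp
    then have "?Q (n + 1 + D * j) \<cong> ?Q (n + 1)"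
      using group.iso_sym[OF group_aug_quotient] by blast
    then show "?Q (n + (D * j + 1)) \<cong> ?Q (n + 1)" by (simp add: ac_simps)
  qed
  then have "?Q n \<cong> ?Q (n + 1)" if "n \<ge> Suc (max M M')" for n
    using Suc_leD[OF that] by blast
  then show ?thesis by blast
qed

end
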